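(* Let $q=p^k$ be a fixed prime power ($p$ prime, $k\ge 1$), and let $n\to\infty$. The number of squarefree, monic polynomials in $\mathbb{F}_q[t]$ of degree $n$ all of whose coefficients lie in $\{0,1\}$ is \[\frac34\cdot\frac1{1+1/p}\cdot 2^n\left(1+O_q\bigl(p^{-n^{1/4}}\bigr)\right).\]
   Context: $\mathbb{F}_q$ is the finite field with $q$ elements, of characteristic $p$. $O_q(\cdot)$ means that the implied constant depends only on $q$. *)

theory Defs
  imports
    Complex_Main
    "HOL-Library.Cardinality"
    "HOL-Library.Landau_Symbols"
    "HOL-Computational_Algebra.Computational_Algebra"
begin

end

theory Submission
  imports "Berlekamp_Zassenhaus.Finite_Field" Defs
begin

text \<open>
A polynomial \<open>f\<close> with coefficients in \<open>{0, 1}\<close> has its coefficients in the prime field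
\<open>F_p\<close>, and it is squarefree over \<open>F_q\<close> iff it is squarefree over \<open>F_p\<close>: both say that
\<open>f\<close> and \<open>f'\<close> satisfy a Bezout identity, because \<open>F_p\<close> is perfect. Everything therefore happens
in \<open>F_p[t]\<close>, where the density of squarefree polynomials should be the product, over the monic
primes \<open>P\<close>, of the probabilities that \<open>P\<^sup>2\<close> does not divide a random \<open>f\<close>.

The prime \<open>t\<close> is special, since divisibility by \<open>t\<^sup>2\<close> only sees the two lowest coefficients: it
has probability \<open>1/4\<close> for coefficients in \<open>{0, 1}\<close>. If \<open>T n\<close> counts the monic polynomials of degree
\<open>n\<close> with coefficients in \<open>{0, 1}\<close> that are squarefree away from \<open>t\<close>, dividing by \<open>t\<^sup>2\<close> shows that \<open>T n - T (n - 2)\<close> counts the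
squarefree ones (\<open>card_squarefree_recursion\<close>), which turns \<open>T n \<approx> 2^n / (1 + 1/p)\<close> into the factor
\<open>3/4\<close>.

For the other primes there are three ingredients.

\<^item> Equidistribution (\<open>equidistribution_01\<close>). Modulo \<open>M\<close> of degree \<open>m\<close> prime to \<open>t\<close>, the powers of \<open>t\<close>
in any window of \<open>m\<close> consecutive exponents form a basis of \<open>F_p[t]/M\<close>. A nontrivial character is
therefore nontrivial at one of them, and the exponential sum over all \<open>f\<close>, which is a product
over the exponents, gains a constant factor \<open>\<rho> < 1\<close> from each window. So
\<open>M\<close> divides \<open>f\<close> with probability \<open>p^-m\<close> up to \<open>\<rho>^(n div m)\<close>.

\<^item> Large primes (\<open>card_large_prime_square_monics_01\<close>). If \<open>P\<^sup>2\<close> divides \<open>f\<close> then \<open>P\<close> divides \<open>f'\<close>,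
and \<open>f'\<close> does not depend on the coefficients of \<open>f\<close> at exponents divisible by \<open>p\<close>. Fixing the other
coefficients leaves at most \<open>n\<close> candidates for \<open>P\<close>, unless \<open>f' = 0\<close>, which is rare; the free part of \<open>f\<close> is a \<open>p\<close>-th power \<open>h^p\<close>, and
\<open>h mod P\<close> is determined. Hence a prime of degree greater than \<open>D\<close> occurs with probability at most
\<open>(n + 1) / 2^D\<close>.

\<^item> Sieve (\<open>sieve_approximation\<close>). The primes of degree at most \<open>D\<close> are handled by inclusion-exclusion
truncated at sets of \<open>r\<close> primes, which by \<open>elementary_symmetric_le\<close> costs only \<open>1 / r!\<close>.

The main term of the truncated sieve is the same for all monic polynomials over \<open>F_p\<close>, where
the number of polynomials that are squarefree away from \<open>t\<close> is known exactly from unique factorization as \<open>A\<^sup>2 B\<close> with \<open>B\<close> squarefree. Running the same sieve there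
(\<open>truncated_density_approx\<close>) identifies the main term as \<open>1 / (1 + 1/p)\<close> without Euler products.

The total error is dominated by \<open>1 / r!\<close>, \<open>n / 2^D\<close> and \<open>p^(D r) \<rho>^(n / (2 r D))\<close>. The last is small
only if \<open>r D\<close> is at most a small multiple of \<open>sqrt n\<close>, while \<open>D\<close> has to exceed \<open>n^(1/4)\<close> by a constant
factor; taking \<open>r\<close> a small and \<open>D\<close> a large multiple of \<open>n^(1/4)\<close> makes every term
\<open>O(p^(-n^(1/4)))\<close> (\<open>sieve_parameters\<close>).
\<close>

section \<open>Truncated inclusion-exclusion\<close>

text \<open>The truncated alternating sum equals \<open>(-1)^(r - 1) * (k - 1 choose r - 1)\<close> for positive \<open>k\<close> and \<open>r\<close>,
and Pascal's rule bounds this by \<open>k choose r\<close>.\<close>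

lemma alternating_binomial_tail:
  "\<bar>(if k = 0 then 1 else 0) - (\<Sum>j<r. (-1) ^ j * real (k choose j))\<bar> \<le> real (k choose r)"
proof (cases r)
  case 0
  then show ?thesis by auto
next
  case (Suc q)
  show ?thesis
  proof (cases k)
    case 0
    then show ?thesis using Suc
      by (simp add: sum.lessThan_Suc_shift del: sum.lessThan_Suc)
  next
    case (Suc l)
    have "(\<Sum>j<r. (-1) ^ j * real (k choose j)) = (\<Sum>j\<le>q. (real k gchoose j) * (-1) ^ j)"
      using \<open>r = Suc q\<close> by (simp add: lessThan_Suc_atMost binomial_gbinomial mult.commute)
    also have "\<dots> = (-1) ^ q * (real l gchoose q)"
      using Suc by (simp add: gbinomial_sum_lower_neg)
    finally have "\<bar>(if k = 0 then 1 else 0) - (\<Sum>j<r. (-1) ^ j * real (k choose j))\<bar> = real (l choose q)"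
      using Suc by (simp add: abs_mult binomial_gbinomial[symmetric])
    also have "\<dots> \<le> real (k choose r)"
      using Suc \<open>r = Suc q\<close> by simp
    finally show ?thesis .
  qed
qed

lemma sum_subsets_by_card:
  fixes f :: "nat \<Rightarrow> real"
  assumes "finite K"
  shows "(\<Sum>S | S \<subseteq> K \<and> card S < r. f (card S)) = (\<Sum>j<r. f j * real (card K choose j))"
proof -
  have fin: "finite {S. S \<subseteq> K \<and> card S < r}"
    using assms by simp
  have "(\<Sum>S | S \<subseteq> K \<and> card S < r. f (card S))
      = (\<Sum>j<r. \<Sum>S | S \<in> {S. S \<subseteq> K \<and> card S < r} \<and> card S = j. f (card S))"
    by (rule sum.group[symmetric]) (use fin in auto)
  also have "\<dots> = (\<Sum>j<r. \<Sum>S | S \<subseteq> K \<and> card S = j. f j)"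
    by (intro sum.cong) auto
  also have "\<dots> = (\<Sum>j<r. f j * real (card K choose j))"
    using n_subsets[OF assms] by (simp add: mult.commute)
  finally show ?thesis .
qed

text \<open>Pointwise, an element \<open>w\<close> that satisfies exactly \<open>k\<close> of the conditions contributes the quantity
estimated in \<open>alternating_binomial_tail\<close>; summing over \<open>w\<close> and exchanging sums gives the claim.
Unlike the usual one-sided Bonferroni inequalities, the bound does not depend on the parity of \<open>r\<close>.\<close>

lemma bonferroni_truncation:
  fixes A :: "'i \<Rightarrow> 'w \<Rightarrow> bool"
  assumes W: "finite W" and I: "finite I"
  shows "\<bar>real (card {w\<in>W. \<forall>i\<in>I. \<not> A i w})
          - (\<Sum>S | S \<subseteq> I \<and> card S < r. (-1) ^ card S * real (card {w\<in>W. \<forall>i\<in>S. A i w}))\<bar>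
        \<le> (\<Sum>S | S \<subseteq> I \<and> card S = r. real (card {w\<in>W. \<forall>i\<in>S. A i w}))"
proof -
  define K where "K w = {i\<in>I. A i w}" for w
  have finK: "finite (K w)" for w using I by (simp add: K_def)
  have finS: "finite {S. S \<subseteq> I \<and> Q S}" for Q
    using I by simp
  have count: "real (card {w\<in>W. P w}) = (\<Sum>w\<in>W. if P w then 1 else 0)" for P
    using W by (simp flip: sum.inter_filter)
  have swap: "(\<Sum>S | S \<subseteq> I \<and> Q S. c S * real (card {w\<in>W. \<forall>i\<in>S. A i w}))
      = (\<Sum>w\<in>W. \<Sum>S | S \<subseteq> K w \<and> Q S. c S)" for c :: "'i set \<Rightarrow> real" and Q
  proof -
    have "(\<Sum>S | S \<subseteq> I \<and> Q S. c S * real (card {w\<in>W. \<forall>i\<in>S. A i w}))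
        = (\<Sum>w\<in>W. \<Sum>S | S \<subseteq> I \<and> Q S. if \<forall>i\<in>S. A i w then c S else 0)"
      unfolding count sum_distrib_left by (subst sum.swap) (intro sum.cong refl, auto)
    also have "\<dots> = (\<Sum>w\<in>W. \<Sum>S | S \<subseteq> K w \<and> Q S. c S)"
    proof (rule sum.cong[OF refl])
      fix w
      have "(\<Sum>S | S \<subseteq> I \<and> Q S. if \<forall>i\<in>S. A i w then c S else 0)
          = sum c {S \<in> {S. S \<subseteq> I \<and> Q S}. \<forall>i\<in>S. A i w}"
        using finS by (rule sum.inter_filter[symmetric])
      also have "{S \<in> {S. S \<subseteq> I \<and> Q S}. \<forall>i\<in>S. A i w} = {S. S \<subseteq> K w \<and> Q S}"
        by (auto simp: K_def)
      finally show "(\<Sum>S | S \<subseteq> I \<and> Q S. if \<forall>i\<in>S. A i w then c S else 0) = (\<Sum>S | S \<subseteq> K w \<and> Q S. c S)" .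
    qed
    finally show ?thesis .
  qed
  have lhs: "real (card {w\<in>W. \<forall>i\<in>I. \<not> A i w}) = (\<Sum>w\<in>W. if card (K w) = 0 then 1 else 0)"
    unfolding count using finK by (intro sum.cong) (auto simp: K_def)
  have rhs: "(\<Sum>S | S \<subseteq> I \<and> card S = r. real (card {w\<in>W. \<forall>i\<in>S. A i w}))
      = (\<Sum>w\<in>W. real (card (K w) choose r))"
    using swap[where c="\<lambda>_. 1" and Q="\<lambda>S. card S = r"] n_subsets[OF finK] by simp
  have "real (card {w\<in>W. \<forall>i\<in>I. \<not> A i w})
          - (\<Sum>S | S \<subseteq> I \<and> card S < r. (-1) ^ card S * real (card {w\<in>W. \<forall>i\<in>S. A i w}))
      = (\<Sum>w\<in>W. (if card (K w) = 0 then 1 else 0) - (\<Sum>j<r. (-1) ^ j * real (card (K w) choose j)))"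
    unfolding lhs swap sum_subsets_by_card[OF finK, where f="\<lambda>j. (-1)^j"] sum_subtractf ..
  also have "\<bar>\<dots>\<bar> \<le> (\<Sum>w\<in>W. real (card (K w) choose r))"
    by (rule order.trans[OF sum_abs]) (intro sum_mono alternating_binomial_tail)
  finally show ?thesis unfolding rhs .
qed

lemma power_Suc_add_ge:
  fixes x a :: real
  assumes "x \<ge> 0" "a \<ge> 0"
  shows "x ^ Suc r + real (Suc r) * a * x ^ r \<le> (x + a) ^ Suc r"
proof (induction r)
  case (Suc r)
  have "x ^ Suc (Suc r) + real (Suc (Suc r)) * a * x ^ Suc r
      \<le> (x + a) * (x ^ Suc r + real (Suc r) * a * x ^ r)"
    using assms by (simp add: algebra_simps)
  also have "\<dots> \<le> (x + a) * (x + a) ^ Suc r"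
    using Suc assms by (intro mult_left_mono) auto
  finally show ?case by simp
qed simp

text \<open>Expanding \<open>(\<Sum>i\<in>I. x i) ^ r\<close> produces every product over an \<open>r\<close>-subset \<open>r!\<close> times.
The induction on \<open>I\<close> replaces this expansion by the first two terms of the binomial theorem.\<close>

lemma elementary_symmetric_le:
  fixes x :: "'i \<Rightarrow> real"
  assumes "finite I" "\<And>i. i \<in> I \<Longrightarrow> x i \<ge> 0"
  shows "(\<Sum>S | S \<subseteq> I \<and> card S = r. \<Prod>i\<in>S. x i) \<le> (\<Sum>i\<in>I. x i) ^ r / fact r"
  using assms
proof (induction I arbitrary: r rule: finite_induct)
  case empty
  have eq: "{S. S = ({} :: 'i set) \<and> card S = r} = (if r = 0 then {{}} else {})" by auto
  show ?case unfolding subset_empty eq by (simp add: power_0_left)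
next
  case (insert a I)
  show ?case
  proof (cases r)
    case 0
    have "{S. S \<subseteq> insert a I \<and> card S = 0} = {{}}"
      using insert.hyps by (auto simp: card_eq_0_iff dest: finite_subset[of _ "insert a I"])
    then show ?thesis using 0 by simp
  next
    case (Suc q)
    let ?X = "\<Sum>i\<in>I. x i"
    have X: "?X \<ge> 0" "x a \<ge> 0" using insert.prems by (auto intro: sum_nonneg)
    have split: "{S. S \<subseteq> insert a I \<and> card S = Suc q}
        = {S. S \<subseteq> I \<and> card S = Suc q} \<union> insert a ` {S. S \<subseteq> I \<and> card S = q}"
    proof (intro equalityI subsetI)
      fix S assume S: "S \<in> {S. S \<subseteq> insert a I \<and> card S = Suc q}"
      show "S \<in> {S. S \<subseteq> I \<and> card S = Suc q} \<union> insert a ` {S. S \<subseteq> I \<and> card S = q}"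
      proof (cases "a \<in> S")
        case True
        then have "S = insert a (S - {a})" "S - {a} \<subseteq> I" "card (S - {a}) = q"
          using S by auto
        then show ?thesis by blast
      qed (use S in auto)
    next
      fix S assume "S \<in> {S. S \<subseteq> I \<and> card S = Suc q} \<union> insert a ` {S. S \<subseteq> I \<and> card S = q}"
      then show "S \<in> {S. S \<subseteq> insert a I \<and> card S = Suc q}"
        using insert.hyps finite_subset[OF _ insert.hyps(1)] by (auto simp: card_insert_if)
    qed
    have inj: "inj_on (insert a) {S. S \<subseteq> I \<and> card S = q}"
      using insert.hyps by (intro inj_onI) (metis insert_ident mem_Collect_eq subsetD)
    have "(\<Sum>S | S \<subseteq> insert a I \<and> card S = Suc q. \<Prod>i\<in>S. x i)
       = (\<Sum>S | S \<subseteq> I \<and> card S = Suc q. \<Prod>i\<in>S. x i)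
         + (\<Sum>S \<in> insert a ` {S. S \<subseteq> I \<and> card S = q}. \<Prod>i\<in>S. x i)"
      unfolding split using insert.hyps by (intro sum.union_disjoint) auto
    also have "(\<Sum>S \<in> insert a ` {S. S \<subseteq> I \<and> card S = q}. \<Prod>i\<in>S. x i)
       = (\<Sum>S | S \<subseteq> I \<and> card S = q. x a * (\<Prod>i\<in>S. x i))"
      using insert.hyps by (subst sum.reindex[OF inj], unfold o_def, intro sum.cong refl prod.insert)
        (auto dest: finite_subset)
    also have "\<dots> = x a * (\<Sum>S | S \<subseteq> I \<and> card S = q. (\<Prod>i\<in>S. x i))"
      by (simp add: sum_distrib_left)
    also have "(\<Sum>S | S \<subseteq> I \<and> card S = Suc q. \<Prod>i\<in>S. x i) + x a * (\<Sum>S | S \<subseteq> I \<and> card S = q. (\<Prod>i\<in>S. x i))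
       \<le> ?X ^ Suc q / fact (Suc q) + x a * (?X ^ q / fact q)"
      using insert.IH[of "Suc q"] insert.IH[of q] insert.prems X
      by (intro add_mono mult_left_mono) auto
    also have "\<dots> = (?X ^ Suc q + real (Suc q) * x a * ?X ^ q) / fact (Suc q)"
      by (simp add: field_simps del: of_nat_Suc)
    also have "\<dots> \<le> (?X + x a) ^ Suc q / fact (Suc q)"
      by (intro divide_right_mono power_Suc_add_ge X) auto
    finally show ?thesis using insert.hyps Suc by (simp add: add.commute)
  qed
qed

text \<open>A subset with at most \<open>r\<close> elements can be listed in \<open>r\<close> slots, where unused slots hold the extra
symbol \<open>None\<close>.\<close>

lemma card_small_subsets_le:
  assumes "finite I"
  shows "card {S. S \<subseteq> I \<and> card S \<le> r} \<le> (card I + 1) ^ r"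
proof -
  have "{S. S \<subseteq> I \<and> card S \<le> r} \<subseteq> (\<lambda>xs. {i. Some i \<in> set xs}) ` {xs. set xs \<subseteq> insert None (Some ` I) \<and> length xs = r}"
  proof
    fix S assume "S \<in> {S. S \<subseteq> I \<and> card S \<le> r}"
    then have S: "S \<subseteq> I" "card S \<le> r" by auto
    obtain ys where ys: "set ys = S" "distinct ys"
      using finite_distinct_list[OF finite_subset[OF S(1) assms]] by blast
    define xs where "xs = map Some ys @ replicate (r - card S) None"
    have "length xs = r" "set xs \<subseteq> insert None (Some ` I)" "S = {i. Some i \<in> set xs}"
      using S ys distinct_card[OF ys(2)] by (auto simp: xs_def)
    then show "S \<in> (\<lambda>xs. {i. Some i \<in> set xs}) ` {xs. set xs \<subseteq> insert None (Some ` I) \<and> length xs = r}"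
      by blast
  qed
  then have "card {S. S \<subseteq> I \<and> card S \<le> r} \<le> card {xs. set xs \<subseteq> insert None (Some ` I) \<and> length xs = r}"
    using assms by (intro surj_card_le finite_lists_length_eq) auto
  also have "\<dots> = (card I + 1) ^ r"
    using assms by (subst card_lists_length_eq) (auto simp: card_insert_if card_image)
  finally show ?thesis .
qed

section \<open>Monic polynomials with prescribed coefficients\<close>

definition monics :: "'a :: comm_semiring_1 set \<Rightarrow> nat \<Rightarrow> 'a poly set" where
  "monics C n = {f. degree f = n \<and> lead_coeff f = 1 \<and> (\<forall>i. poly.coeff f i \<in> C)}"

definition polys_below :: "nat \<Rightarrow> 'a :: zero poly set" where
  "polys_below m = {a. \<forall>i\<ge>m. poly.coeff a i = 0}"

lemma polys_below_0: "polys_below 0 = {0}"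
  by (auto simp: polys_below_def poly_eq_iff)

lemma polys_below_Suc: "polys_below (Suc m) = (\<lambda>(c, a). pCons c a) ` (UNIV \<times> polys_below m)"
proof (intro equalityI subsetI)
  fix a :: "'a poly" assume a: "a \<in> polys_below (Suc m)"
  obtain c b where b: "a = pCons c b" by (cases a) auto
  have "b \<in> polys_below m"
    using a by (force simp: b polys_below_def coeff_pCons split: nat.splits)
  then show "a \<in> (\<lambda>(c, a). pCons c a) ` (UNIV \<times> polys_below m)" using b by auto
qed (auto simp: polys_below_def coeff_pCons split: nat.splits)

lemma card_polys_below:
  "finite (polys_below m :: 'a :: {finite, zero} poly set) \<and> card (polys_below m :: 'a poly set) = CARD('a) ^ m"
proof (induction m)
  case (Suc m)
  have "inj_on (\<lambda>(c, a :: 'a poly). pCons c a) (UNIV \<times> polys_below m)"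
    by (auto intro!: inj_onI)
  then show ?case
    using Suc by (simp add: polys_below_Suc card_image card_cartesian_product)
qed (simp add: polys_below_0)

lemma degree_less_imp_polys_below: "degree a < m \<Longrightarrow> a \<in> polys_below m"
  by (auto simp: polys_below_def coeff_eq_0)

lemma polys_below_dvd_imp_0:
  fixes a M :: "'a :: field poly"
  assumes "a \<in> polys_below m" "degree M \<ge> m" "M dvd a"
  shows "a = 0"
proof (rule ccontr)
  assume "a \<noteq> 0"
  then have "degree a < m"
    using assms(1) leading_coeff_0_iff[of a] by (auto simp: polys_below_def not_le[symmetric])
  moreover have "degree M \<le> degree a"
    using assms \<open>a \<noteq> 0\<close> by (intro dvd_imp_degree_le)
  ultimately show False using assms by simp
qed

lemma monics_UNIV_eq:
  "monics UNIV n = (\<lambda>a. Polynomial.monom 1 n + a) ` (polys_below n :: 'a :: comm_ring_1 poly set)"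
proof (intro equalityI subsetI)
  fix f :: "'a poly" assume f: "f \<in> monics UNIV n"
  have "f - Polynomial.monom 1 n \<in> polys_below n"
    using f by (auto simp: monics_def polys_below_def le_less coeff_eq_0)
  then show "f \<in> (\<lambda>a. Polynomial.monom 1 n + a) ` polys_below n"
    by (intro image_eqI[where x="f - Polynomial.monom 1 n"]) auto
next
  fix f :: "'a poly" assume "f \<in> (\<lambda>a. Polynomial.monom 1 n + a) ` polys_below n"
  then obtain a where a: "f = Polynomial.monom 1 n + a" "a \<in> polys_below n" by auto
  have "poly.coeff f n = 1" "\<And>i. i > n \<Longrightarrow> poly.coeff f i = 0"
    using a by (auto simp: polys_below_def)
  then have "degree f = n"
    by (intro antisym degree_le le_degree) auto
  then show "f \<in> monics UNIV n"
    using \<open>poly.coeff f n = 1\<close> by (simp add: monics_def)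
qed

lemma finite_monics_UNIV: "finite (monics UNIV n :: 'a :: {finite, comm_ring_1} poly set)"
  and card_monics_UNIV: "card (monics UNIV n :: 'a :: {finite, comm_ring_1} poly set) = CARD('a) ^ n"
  using card_polys_below[of n, where 'a='a] by (auto simp: monics_UNIV_eq card_image inj_on_def)

lemma finite_monics: "finite (monics C n :: 'a :: {finite, comm_ring_1} poly set)"
  by (rule finite_subset[OF _ finite_monics_UNIV[of n]]) (auto simp: monics_def)

definition indicator_poly :: "nat set \<Rightarrow> 'a :: comm_semiring_1 poly" where
  "indicator_poly S = (\<Sum>i\<in>S. Polynomial.monom 1 i)"

lemma coeff_indicator_poly:
  "finite S \<Longrightarrow> poly.coeff (indicator_poly S) j = (if j \<in> S then 1 else 0)"
  by (simp add: indicator_poly_def coeff_sum)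

lemma indicator_poly_Un_disjoint:
  "finite S \<Longrightarrow> finite T \<Longrightarrow> S \<inter> T = {} \<Longrightarrow>
     indicator_poly (S \<union> T) = indicator_poly S + indicator_poly T"
  unfolding indicator_poly_def by (rule sum.union_disjoint)

lemma bij_betw_monics_01:
  "bij_betw (\<lambda>S. indicator_poly (insert n S)) (Pow {..<n}) (monics {0, 1 :: 'a :: comm_ring_1} n)"
proof -
  have deg: "degree (indicator_poly (insert n S) :: 'a poly) = n"
       "lead_coeff (indicator_poly (insert n S) :: 'a poly) = 1" if "S \<subseteq> {..<n}" for S
  proof -
    have fin: "finite S" using that finite_subset by blast
    show 1: "degree (indicator_poly (insert n S) :: 'a poly) = n"
      by (intro antisym degree_le le_degree) (use that fin in \<open>auto simp: coeff_indicator_poly\<close>)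
    show "lead_coeff (indicator_poly (insert n S) :: 'a poly) = 1"
      unfolding 1 using fin by (simp add: coeff_indicator_poly)
  qed
  show ?thesis
  proof (rule bij_betwI)
    show "(\<lambda>S. indicator_poly (insert n S)) \<in> Pow {..<n} \<rightarrow> monics {0, 1 :: 'a} n"
      using deg by (auto simp: monics_def coeff_indicator_poly finite_subset)
    show "(\<lambda>f. {i. i < n \<and> poly.coeff f i = 1}) \<in> monics {0, 1 :: 'a} n \<rightarrow> Pow {..<n}"
      by auto
    show "{i. i < n \<and> poly.coeff (indicator_poly (insert n S)) i = (1 :: 'a)} = S"
      if "S \<in> Pow {..<n}" for S
      using that finite_subset[of S "{..<n}"] by (auto simp: coeff_indicator_poly split: if_splits)
    show "indicator_poly (insert n {i. i < n \<and> poly.coeff f i = 1}) = f"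
      if "f \<in> monics {0, 1 :: 'a} n" for f
    proof (rule poly_eqI)
      fix i
      show "poly.coeff (indicator_poly (insert n {i. i < n \<and> poly.coeff f i = 1})) i = poly.coeff f i"
        using that by (cases i n rule: linorder_cases) (auto simp: coeff_indicator_poly monics_def coeff_eq_0)
    qed
  qed
qed

lemma card_monics_01: "card (monics {0, 1 :: 'a :: comm_ring_1} n) = 2 ^ n"
  using bij_betw_same_card[OF bij_betw_monics_01[of n, where 'a='a]] by (simp add: card_Pow)

lemma card_monics_dvd:
  fixes M :: "'a :: {finite, field} poly"
  assumes "lead_coeff M = 1" "degree M \<le> n"
  shows "card {f \<in> monics UNIV n. M dvd f} = CARD('a) ^ (n - degree M)"
proof -
  have M: "M \<noteq> 0" using assms by auto
  have "{f \<in> monics UNIV n. M dvd f} = (\<lambda>g. M * g) ` monics UNIV (n - degree M)"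
  proof (intro equalityI subsetI)
    fix f assume f: "f \<in> {f \<in> monics UNIV n. M dvd f}"
    then obtain g where g: "f = M * g" by blast
    have "f \<noteq> 0" using f by (auto simp: monics_def)
    then have "degree f = degree M + degree g"
      using g by (auto simp: degree_mult_eq)
    moreover have "lead_coeff g = 1"
      using f assms lead_coeff_mult[of M g] by (auto simp: g monics_def)
    ultimately have "g \<in> monics UNIV (n - degree M)"
      using f by (auto simp: monics_def)
    then show "f \<in> (\<lambda>g. M * g) ` monics UNIV (n - degree M)" using g by auto
  next
    fix f assume "f \<in> (\<lambda>g. M * g) ` monics UNIV (n - degree M)"
    then obtain g where g: "f = M * g" "g \<in> monics UNIV (n - degree M)" by auto
    then have "g \<noteq> 0" by (auto simp: monics_def)
    then have "degree f = n"
      using g assms M by (auto simp: monics_def degree_mult_eq)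
    moreover have "lead_coeff f = 1"
      using g assms by (auto simp: monics_def lead_coeff_mult)
    ultimately show "f \<in> {f \<in> monics UNIV n. M dvd f}"
      using g by (auto simp: monics_def)
  qed
  then show ?thesis
    using M by (simp add: card_image inj_on_def card_monics_UNIV)
qed

section \<open>Equidistribution of polynomials with coefficients 0 and 1\<close>

definition additive_character :: "'b :: prime_card mod_ring \<Rightarrow> complex" where
  "additive_character x = cis (2 * pi * of_int (to_int_mod_ring x) / of_nat CARD('b))"

lemma additive_character_0 [simp]: "additive_character 0 = 1"
  by (simp add: additive_character_def)

lemma norm_additive_character [simp]: "norm (additive_character x) = 1"
  by (simp add: additive_character_def)

lemma additive_character_add:
  "additive_character (x + y :: 'b :: prime_card mod_ring) = additive_character x * additive_character y"
proof -
  let ?p = "int CARD('b)"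
  let ?s = "to_int_mod_ring x + to_int_mod_ring y"
  have "real_of_int ?s = of_int (?s mod ?p) + of_nat CARD('b) * of_int (?s div ?p)"
    by (metis (no_types, lifting) add.commute mult_div_mod_eq of_int_add of_int_mult of_int_of_nat_eq)
  then have "2 * pi * of_int ?s / of_nat CARD('b)
       = 2 * pi * of_int (?s mod ?p) / of_nat CARD('b) + 2 * pi * of_int (?s div ?p)"
    by (simp add: field_simps)
  then have "cis (2 * pi * of_int ?s / of_nat CARD('b)) = cis (2 * pi * of_int (?s mod ?p) / of_nat CARD('b))"
    by (simp add: cis_mult[symmetric])
  then show ?thesis
    by (simp add: additive_character_def to_int_mod_ring_add cis_mult add_divide_distrib algebra_simps)
qed

lemma additive_character_sum:
  "finite A \<Longrightarrow> additive_character (sum f A) = (\<Prod>i\<in>A. additive_character (f i))"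
  by (induction A rule: finite_induct) (simp_all add: additive_character_add)

lemma additive_character_eq_1_iff: "additive_character x = 1 \<longleftrightarrow> x = (0 :: 'b :: prime_card mod_ring)"
proof
  let ?a = "to_int_mod_ring x"
  assume "additive_character x = 1"
  then have "cos (2 * pi * of_int ?a / of_nat CARD('b)) = 1"
    by (simp add: additive_character_def complex_eq_iff)
  then obtain n :: int where "2 * pi * of_int ?a / of_nat CARD('b) = of_int n * 2 * pi"
    unfolding cos_one_2pi_int by blast
  then have "real_of_int ?a = of_int n * of_nat CARD('b)"
    by (simp add: field_simps)
  then have "?a = n * int CARD('b)"
    by (metis of_int_eq_iff of_int_mult of_int_of_nat_eq)
  moreover have "0 \<le> ?a" "?a < int CARD('b)"
    by (transfer, simp)+
  ultimately have "?a = 0"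
    by (metis mod_mult_self2_is_0 mod_pos_pos_trivial)
  then show "x = 0"
    by (metis of_int_mod_ring_to_int_mod_ring of_int_of_int_mod_ring of_int_0)
qed simp

lemma norm_one_plus_additive_character_le: "norm (1 + additive_character x) \<le> 2"
  using norm_triangle_ineq[of 1 "additive_character x"] by simp

lemma norm_one_plus_additive_character_less:
  assumes "x \<noteq> 0"
  shows "norm (1 + additive_character x) < 2"
proof -
  obtain t where t: "additive_character x = cis t"
    by (auto simp: additive_character_def)
  have "cos t \<noteq> 1"
  proof
    assume "cos t = 1"
    then have "sin t = 0" using sin_cos_squared_add[of t] by simp
    then show False
      using assms \<open>cos t = 1\<close> t additive_character_eq_1_iff[of x] by (simp add: complex_eq_iff)
  qed
  then have "cos t < 1" using cos_le_one[of t] by linarith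
  have "(norm (1 + additive_character x))\<^sup>2 = (1 + cos t)\<^sup>2 + (sin t)\<^sup>2"
    by (simp add: t cmod_power2)
  also have "\<dots> = 2 + 2 * cos t"
    using sin_cos_squared_add[of t] by (simp add: power2_eq_square algebra_simps)
  also have "\<dots> < 2\<^sup>2" using \<open>cos t < 1\<close> by simp
  finally show ?thesis by (rule power_less_imp_less_base) simp
qed

text \<open>The constant \<open>\<rho>\<close> exists because \<open>F_p\<close> is finite and \<open>1 + additive_character x\<close> has norm \<open>2\<close> only
at \<open>x = 0\<close>. For odd \<open>p\<close> one could take \<open>cos (pi / p)\<close>, but only the existence of \<open>\<rho>\<close> matters.\<close>

lemma additive_character_contraction:
  obtains \<rho> :: real where "0 < \<rho>" "\<rho> < 1"
    "\<And>x :: 'b :: prime_card mod_ring. x \<noteq> 0 \<Longrightarrow> norm (1 + additive_character x) \<le> 2 * \<rho>"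
proof
  \<comment> \<open>The element \<open>1/2\<close> keeps the maximum positive when \<open>p = 2\<close>, where the norm is \<open>0\<close>.\<close>
  let ?R = "insert (1/2) ((\<lambda>x :: 'b mod_ring. norm (1 + additive_character x) / 2) ` (- {0}))"
  have "Max ?R \<in> ?R" by (rule Max_in) auto
  then show "Max ?R < 1"
    using norm_one_plus_additive_character_less by force
  show "0 < Max ?R"
    by (rule less_le_trans[OF _ Max_ge[of _ "1/2"]]) auto
  show "norm (1 + additive_character x) \<le> 2 * Max ?R" if "x \<noteq> 0" for x :: "'b mod_ring"
  proof -
    have "norm (1 + additive_character x) / 2 \<le> Max ?R"
      using that by (intro Max_ge) auto
    then show ?thesis by simp
  qed
qed

text \<open>The functionals \<open>residue_pairing M a\<close>, for \<open>a\<close> of degree less than that of \<open>M\<close>, are all linear forms on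
the quotient of the polynomial ring by \<open>M\<close>; composed with the additive character they give all
characters of the quotient.\<close>

definition residue_pairing :: "'a :: field poly \<Rightarrow> 'a poly \<Rightarrow> 'a poly \<Rightarrow> 'a" where
  "residue_pairing M a g = (\<Sum>j<degree M. poly.coeff a j * poly.coeff (g mod M) j)"

lemma residue_pairing_add_left: "residue_pairing M (a + b) g = residue_pairing M a g + residue_pairing M b g"
  by (simp add: residue_pairing_def algebra_simps sum.distrib)

lemma residue_pairing_add_right: "residue_pairing M a (g + h) = residue_pairing M a g + residue_pairing M a h"
  by (simp add: residue_pairing_def poly_mod_add_left algebra_simps sum.distrib)

lemma residue_pairing_0_left [simp]: "residue_pairing M 0 g = 0"
  by (simp add: residue_pairing_def)

lemma residue_pairing_0_right [simp]: "residue_pairing M a 0 = 0"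
  by (simp add: residue_pairing_def)

lemma residue_pairing_sum_right:
  "residue_pairing M a (\<Sum>i\<in>A. g i) = (\<Sum>i\<in>A. residue_pairing M a (g i))"
  by (induction A rule: infinite_finite_induct) (simp_all add: residue_pairing_add_right)

lemma residue_pairing_smult_right:
  "residue_pairing M a (Polynomial.smult c g) = c * residue_pairing M a g"
  by (simp add: residue_pairing_def mod_smult_left sum_distrib_left algebra_simps)

lemma residue_pairing_cong:
  "g mod M = h mod M \<Longrightarrow> residue_pairing M a g = residue_pairing M a h"
  by (simp add: residue_pairing_def)

lemma residue_pairing_monom:
  assumes "j < degree M"
  shows "residue_pairing M a (Polynomial.monom 1 j) = poly.coeff a j"
proof -
  have "Polynomial.monom 1 j mod M = Polynomial.monom 1 j"
    using assms by (intro mod_poly_less) (simp add: degree_monom_eq)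
  then have "residue_pairing M a (Polynomial.monom 1 j) = (\<Sum>i<degree M. if i = j then poly.coeff a j else 0)"
    unfolding residue_pairing_def by (intro sum.cong) auto
  then show ?thesis using assms by simp
qed

text \<open>Orthogonality of characters: translating the summation variable by some \<open>b\<close> that pairs nontrivially
with \<open>g\<close> multiplies the sum by a number different from \<open>1\<close>.\<close>

lemma sum_additive_character_pairing:
  fixes M g :: "'b :: prime_card mod_ring poly"
  assumes "degree M > 0"
  shows "(\<Sum>a\<in>polys_below (degree M). additive_character (residue_pairing M a g))
           = (if M dvd g then of_nat (CARD('b) ^ degree M) else 0)"
proof (cases "M dvd g")
  case True
  then have "residue_pairing M a g = 0" for a
    by (simp add: residue_pairing_def)
  then show ?thesis using True card_polys_below[of "degree M", where 'a = "'b mod_ring"] by simp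
next
  case False
  let ?V = "polys_below (degree M) :: 'b mod_ring poly set"
  have "g mod M \<noteq> 0" using False by (simp add: mod_eq_0_iff_dvd)
  then obtain j where j: "poly.coeff (g mod M) j \<noteq> 0" by (auto simp: poly_eq_iff)
  have "degree (g mod M) < degree M"
    using degree_mod_less'[of M g] assms \<open>g mod M \<noteq> 0\<close> by fastforce
  then have jm: "j < degree M" using j le_degree by (metis le_less_trans)
  define b where "b = Polynomial.monom (1 :: 'b mod_ring) j"
  have bV: "b \<in> ?V" using jm by (auto simp: b_def polys_below_def)
  have "residue_pairing M b g = (\<Sum>i<degree M. if i = j then poly.coeff (g mod M) j else 0)"
    unfolding residue_pairing_def b_def by (intro sum.cong) auto
  then have bg: "residue_pairing M b g \<noteq> 0" using j jm by simp
  have bij: "bij_betw (\<lambda>a. a + b) ?V ?V"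
    using bV by (intro bij_betwI[where g = "\<lambda>a. a - b"]) (auto simp: polys_below_def)
  have "(\<Sum>a\<in>?V. additive_character (residue_pairing M a g))
      = (\<Sum>a\<in>?V. additive_character (residue_pairing M (a + b) g))"
    by (rule sum.reindex_bij_betw[OF bij, symmetric])
  also have "\<dots> = (\<Sum>a\<in>?V. additive_character (residue_pairing M a g)) * additive_character (residue_pairing M b g)"
    by (simp add: residue_pairing_add_left additive_character_add sum_distrib_right)
  finally have "(\<Sum>a\<in>?V. additive_character (residue_pairing M a g)) = 0"
    using bg by (simp add: additive_character_eq_1_iff)
  then show ?thesis using False by simp
qed

text \<open>If the form vanished on \<open>t^k, ..., t^(k + m - 1)\<close> with \<open>m = degree M\<close>, it would vanish on \<open>t^k * g\<close>
for every \<open>g\<close>, hence everywhere, as \<open>t^k\<close> is a unit modulo \<open>M\<close>.\<close>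

lemma residue_pairing_window:
  fixes M a :: "'a :: {field_gcd} poly"
  assumes cop: "coprime M [:0, 1:]" and a: "a \<in> polys_below (degree M)" "a \<noteq> 0"
  shows "\<exists>j<degree M. residue_pairing M a (Polynomial.monom 1 (k + j)) \<noteq> 0"
proof (rule ccontr)
  assume "\<not> ?thesis"
  then have zero: "residue_pairing M a (Polynomial.monom 1 (k + j)) = 0" if "j < degree M" for j
    using that by blast
  define T :: "'a poly" where "T = Polynomial.monom 1 k"
  have low: "residue_pairing M a (T * g) = 0" if g: "g \<in> polys_below (degree M)" for g
  proof -
    have "g = (\<Sum>j<degree M. Polynomial.smult (poly.coeff g j) (Polynomial.monom 1 j))"
    proof (rule poly_eqI)
      fix i
      have "poly.coeff (\<Sum>j<degree M. Polynomial.smult (poly.coeff g j) (Polynomial.monom 1 j)) i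
          = (\<Sum>j<degree M. if j = i then poly.coeff g i else 0)"
        unfolding coeff_sum by (intro sum.cong) auto
      then show "poly.coeff g i = poly.coeff (\<Sum>j<degree M. Polynomial.smult (poly.coeff g j) (Polynomial.monom 1 j)) i"
        using g by (auto simp: polys_below_def not_less)
    qed
    then have "T * g = (\<Sum>j<degree M. Polynomial.smult (poly.coeff g j) (Polynomial.monom 1 (k + j)))"
      by (metis (no_types, lifting) T_def mult_monom mult_smult_right mult_1 sum.cong sum_distrib_left)
    then show ?thesis
      using zero by (simp add: residue_pairing_sum_right residue_pairing_smult_right)
  qed
  have all: "residue_pairing M a (T * g) = 0" for g
  proof -
    have "(T * g) mod M = (T * (g mod M)) mod M" by (simp add: mod_mult_right_eq)
    moreover have "g mod M \<in> polys_below (degree M)"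
    proof (cases "g mod M = 0")
      case False
      have "M \<noteq> 0" using a by (metis degree_0 polys_below_0 singletonD)
      then show ?thesis using degree_mod_less'[of M g] False by (intro degree_less_imp_polys_below) auto
    qed (simp add: polys_below_def)
    ultimately show ?thesis using low residue_pairing_cong by metis
  qed
  have "T = [:0, 1:] ^ k" by (simp add: T_def monom_altdef)
  then have "coprime T M" using cop by (simp add: coprime_commute)
  then obtain u v where uv: "u * T + v * M = 1"
    using bezout_coefficients_fst_snd[of T M] by (metis coprime_imp_gcd_eq_1)
  have any: "residue_pairing M a h = 0" for h
  proof -
    have "h = T * (u * h) + (v * h) * M"
      using arg_cong[OF uv, of "\<lambda>w. w * h"] by (simp add: algebra_simps)
    then have "h mod M = (T * (u * h)) mod M"
      by (metis mod_mult_self1)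
    then show ?thesis using all residue_pairing_cong by metis
  qed
  have "poly.coeff a j = 0" for j
    using any[of "Polynomial.monom 1 j"] residue_pairing_monom[of j M a] a(1)
    by (cases "j < degree M") (auto simp: polys_below_def)
  then show False using a by (simp add: poly_eq_iff)
qed

text \<open>The exponents below \<open>n\<close> contain \<open>n div m\<close> disjoint windows of length \<open>m\<close>, and each of them
contributes a factor at most \<open>\<rho>\<close>.\<close>

lemma prod_le_power_if_windows:
  fixes w :: "nat \<Rightarrow> real"
  assumes "m > 0" "\<And>i. 0 \<le> w i" "\<And>i. w i \<le> 1" "0 \<le> \<rho>"
    and window: "\<And>k. \<exists>j<m. w (k + j) \<le> \<rho>"
  shows "(\<Prod>i<n. w i) \<le> \<rho> ^ (n div m)"
proof -
  have blocks: "(\<Prod>i<q * m. w i) \<le> \<rho> ^ q" for q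
  proof (induction q)
    case (Suc q)
    obtain j where j: "j < m" "w (q * m + j) \<le> \<rho>" using window by blast
    have "(\<Prod>i<Suc q * m. w i) = (\<Prod>i<q * m. w i) * (\<Prod>i\<in>{q * m..<q * m + m}. w i)"
      by (subst prod.union_disjoint[symmetric]) (auto intro!: prod.cong)
    also have "(\<Prod>i\<in>{q * m..<q * m + m}. w i) = w (q * m + j) * (\<Prod>i\<in>{q * m..<q * m + m} - {q * m + j}. w i)"
      using j by (intro prod.remove) auto
    also have "\<dots> \<le> \<rho> * 1"
      using assms j by (intro mult_mono prod_le_1 prod_nonneg) auto
    finally show ?case
      using Suc assms by (smt (verit) mult_mono power_Suc2 prod_nonneg mult_1_right mult_left_mono)
  qed simp
  have "(\<Prod>i<n. w i) = (\<Prod>i<n div m * m. w i) * (\<Prod>i\<in>{n div m * m..<n}. w i)"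
    by (subst prod.union_disjoint[symmetric]) (auto intro!: prod.cong intro: less_le_trans[OF _ div_times_less_eq_dividend])
  also have "\<dots> \<le> \<rho> ^ (n div m) * 1"
    using assms blocks by (intro mult_mono prod_le_1 prod_nonneg) auto
  finally show ?thesis by simp
qed

text \<open>Detect divisibility by \<open>M\<close> with the orthogonality relation. The trivial character gives the main
term. For any other \<open>a\<close> the sum over \<open>f\<close> factors as a product of \<open>1 + additive_character (u a i)\<close> over
the exponents \<open>i < n\<close>, since each coefficient of \<open>f\<close> is chosen freely from \<open>{0, 1}\<close>; by
\<open>residue_pairing_window\<close> and \<open>prod_le_power_if_windows\<close> this product is small.\<close>

lemma equidistribution_01:
  fixes M :: "'b :: prime_card mod_ring poly"
  assumes rho: "0 < \<rho>" "\<And>x :: 'b mod_ring. x \<noteq> 0 \<Longrightarrow> norm (1 + additive_character x) \<le> 2 * \<rho>"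
    and M: "coprime M [:0, 1:]" "degree M > 0"
  shows "\<bar>real (card {f \<in> monics {0, 1} n. M dvd f}) - 2 ^ n / CARD('b) ^ degree M\<bar>
           \<le> 2 ^ n * \<rho> ^ (n div degree M)"
proof -
  let ?V = "polys_below (degree M) :: 'b mod_ring poly set"
  let ?q = "real (CARD('b) ^ degree M)"
  define u where "u a i = residue_pairing M a (Polynomial.monom 1 i)" for a i
  define Z where "Z = card {f \<in> monics {0, 1 :: 'b mod_ring} n. M dvd f}"
  define c where "c a = (\<Sum>f\<in>monics {0, 1} n. additive_character (residue_pairing M a f))" for a
  have V: "finite ?V" "card ?V = CARD('b) ^ degree M" "0 \<in> ?V"
    using card_polys_below[of "degree M", where 'a = "'b mod_ring"] by (auto simp: polys_below_def)
  have c_eq: "c a = additive_character (u a n) * (\<Prod>i<n. 1 + additive_character (u a i))" for a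
  proof -
    have "c a = (\<Sum>S\<in>Pow {..<n}. additive_character (residue_pairing M a (indicator_poly (insert n S))))"
      unfolding c_def by (rule sum.reindex_bij_betw[OF bij_betw_monics_01, symmetric])
    also have "\<dots> = (\<Sum>S\<in>Pow {..<n}. additive_character (u a n) * (\<Prod>i\<in>S. additive_character (u a i)))"
    proof (intro sum.cong refl)
      fix S assume "S \<in> Pow {..<n}"
      then have "finite S" "n \<notin> S" using finite_subset by auto
      then show "additive_character (residue_pairing M a (indicator_poly (insert n S)))
          = additive_character (u a n) * (\<Prod>i\<in>S. additive_character (u a i))"
        by (simp add: indicator_poly_def residue_pairing_add_right residue_pairing_sum_right
            additive_character_add additive_character_sum u_def)
    qed
    also have "\<dots> = additive_character (u a n) * (\<Prod>i<n. additive_character (u a i) + 1)"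
      by (subst prod_add) (simp_all add: sum_distrib_left)
    finally show ?thesis by (simp add: add.commute)
  qed
  have "(\<Sum>a\<in>?V. c a) = (\<Sum>f\<in>monics {0, 1} n. if M dvd f then of_nat (CARD('b) ^ degree M) else 0)"
    unfolding c_def by (subst sum.swap) (simp only: sum_additive_character_pairing[OF M(2)])
  also have "\<dots> = of_real (?q * Z)"
    by (simp add: sum.If_cases Z_def finite_monics Int_def mult.commute flip: of_nat_power)
  finally have "of_real (?q * Z) = c 0 + (\<Sum>a\<in>?V - {0}. c a)"
    using V by (simp add: sum.remove)
  moreover have "c 0 = of_real (2 ^ n)"
    by (simp add: c_eq u_def)
  ultimately have "of_real (?q * Z - 2 ^ n) = (\<Sum>a\<in>?V - {0}. c a)"
    by simp
  then have "\<bar>?q * Z - 2 ^ n\<bar> = norm (\<Sum>a\<in>?V - {0}. c a)"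
    by (metis norm_of_real)
  also have "\<dots> \<le> (\<Sum>a\<in>?V - {0}. 2 ^ n * \<rho> ^ (n div degree M))"
  proof (rule order.trans[OF norm_sum sum_mono])
    fix a assume a: "a \<in> ?V - {0}"
    have "norm (c a) = 2 ^ n * (\<Prod>i<n. norm (1 + additive_character (u a i)) / 2)"
      by (simp add: c_eq norm_mult prod_dividef flip: prod_norm)
    also have "(\<Prod>i<n. norm (1 + additive_character (u a i)) / 2) \<le> \<rho> ^ (n div degree M)"
    proof (rule prod_le_power_if_windows)
      fix k
      obtain j where "j < degree M" "u a (k + j) \<noteq> 0"
        using residue_pairing_window[OF M(1), of a k] a by (auto simp: u_def)
      then show "\<exists>j<degree M. norm (1 + additive_character (u a (k + j))) / 2 \<le> \<rho>"
        using rho(2)[of "u a (k + j)"] by (intro exI[of _ j]) auto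
    qed (use M rho norm_one_plus_additive_character_le in auto)
    finally show "norm (c a) \<le> 2 ^ n * \<rho> ^ (n div degree M)" by simp
  qed
  also have "\<dots> \<le> ?q * (2 ^ n * \<rho> ^ (n div degree M))"
    using V rho(1) by (simp add: mult_right_mono)
  finally have "\<bar>?q * Z - 2 ^ n\<bar> / ?q \<le> 2 ^ n * \<rho> ^ (n div degree M)"
    by (simp add: divide_le_eq mult.commute)
  moreover have "?q > 0" by simp
  ultimately have "\<bar>(?q * Z - 2 ^ n) / ?q\<bar> \<le> 2 ^ n * \<rho> ^ (n div degree M)"
    by simp
  moreover have "(?q * Z - 2 ^ n) / ?q = Z - 2 ^ n / CARD('b) ^ degree M"
    by (simp add: diff_divide_distrib)
  ultimately show ?thesis by (simp only: Z_def)
qed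

section \<open>The sieve over primes of bounded degree\<close>

lemma lead_coeff_normalized_poly:
  fixes P :: "'a :: field_gcd poly"
  assumes "normalize P = P" "P \<noteq> 0"
  shows "lead_coeff P = 1"
proof -
  have "unit_factor P = 1"
    using assms unit_factor_mult_normalize[of P] by (metis mult_cancel_right1)
  then have "unit_factor (lead_coeff P) = 1"
    by (simp add: unit_factor_poly_def monom_0 one_pCons)
  moreover have "normalize (lead_coeff P) = 1"
    using assms by (intro is_unit_normalize) (simp add: dvd_field_iff)
  ultimately show ?thesis
    using unit_factor_mult_normalize[of "lead_coeff P"] by simp
qed

lemma lead_coeff_prime_poly: "prime P \<Longrightarrow> lead_coeff (P :: 'a :: field_gcd poly) = 1"
  by (rule lead_coeff_normalized_poly) auto

lemma degree_prime_poly_pos: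
  fixes P :: "'a :: field_gcd poly"
  assumes "prime P"
  shows "degree P > 0"
  using assms by (metis is_unit_iff_degree not_prime_unit not_prime_0 neq0_conv)

lemma prime_poly_in_monics: "prime P \<Longrightarrow> P \<in> monics UNIV (degree (P :: 'a :: field_gcd poly))"
  by (simp add: monics_def lead_coeff_prime_poly)

lemma prime_poly_X: "prime ([:0, 1:] :: 'a :: field_gcd poly)"
proof (rule primeI)
  show "prime_elem ([:0, 1:] :: 'a poly)"
    by (intro prime_elem_linear_poly) auto
qed (simp add: normalize_poly_eq_map_poly map_poly_pCons)

definition small_primes :: "nat \<Rightarrow> 'a :: field_gcd poly set" where
  "small_primes D = {P. prime P \<and> degree P \<le> D \<and> P \<noteq> [:0, 1:]}"

lemma finite_small_primes: "finite (small_primes D :: 'a :: {finite, field_gcd} poly set)"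
  and card_small_primes_less: "card (small_primes D :: 'a :: {finite, field_gcd} poly set) < CARD('a) ^ Suc D"
proof -
  have sub: "small_primes D \<subseteq> polys_below (Suc D) - {0 :: 'a poly}"
    by (auto simp: small_primes_def intro: degree_less_imp_polys_below)
  have fin: "finite (polys_below (Suc D) :: 'a poly set)"
    and card: "card (polys_below (Suc D) :: 'a poly set) = CARD('a) ^ Suc D"
    using card_polys_below by blast+
  show "finite (small_primes D :: 'a poly set)"
    using sub fin by (auto intro: finite_subset)
  have "0 \<in> (polys_below (Suc D) :: 'a poly set)" by (simp add: polys_below_def)
  then have "polys_below (Suc D) - {0 :: 'a poly} \<subset> polys_below (Suc D)" by blast
  then show "card (small_primes D :: 'a poly set) < CARD('a) ^ Suc D"
    using sub fin unfolding card[symmetric] by (intro psubset_card_mono) auto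
qed

lemma geometric_tail_le:
  fixes q :: nat
  assumes "q \<ge> 2"
  shows "(\<Sum>d\<in>{D<..n}. 1 / real q ^ d) \<le> 1 / real q ^ D"
proof -
  have "(\<Sum>d\<in>{D<..n}. 1 / real q ^ d) \<le> 1 / real q ^ D - 1 / real q ^ n" if "D \<le> n"
    using that
  proof (induction n rule: dec_induct)
    case (step n)
    have "{D<..Suc n} = insert (Suc n) {D<..n}" using step by auto
    moreover have "2 / real q ^ Suc n \<le> 1 / real q ^ n"
      using assms by (simp add: field_simps)
    ultimately show ?case using step by simp
  qed simp
  then show ?thesis
    by (cases "D \<le> n") (auto intro: order.trans)
qed

lemma two_le_CARD_field: "2 \<le> CARD('a :: {finite, field})"
  using card_mono[of UNIV "{0, 1 :: 'a}"] by simp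

text \<open>There are at most \<open>q^d\<close> primes of degree \<open>d\<close>, so the sum is at most that of \<open>q^-d\<close> over positive \<open>d\<close>.\<close>

lemma sum_small_primes_le_1:
  "(\<Sum>P\<in>(small_primes D :: 'a :: {finite, field_gcd} poly set). 1 / real CARD('a) ^ (2 * degree P)) \<le> 1"
proof -
  let ?q = "CARD('a)"
  have "(\<Sum>P\<in>(small_primes D :: 'a poly set). 1 / real ?q ^ (2 * degree P))
      = (\<Sum>d\<in>{0<..D}. \<Sum>P\<in>{P\<in>small_primes D. degree (P :: 'a poly) = d}. 1 / real ?q ^ (2 * degree P))"
    by (intro sum.group[symmetric] finite_small_primes) (auto simp: small_primes_def degree_prime_poly_pos)
  also have "\<dots> \<le> (\<Sum>d\<in>{0<..D}. 1 / real ?q ^ d)"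
  proof (rule sum_mono)
    fix d
    have "(\<Sum>P\<in>{P\<in>small_primes D. degree (P :: 'a poly) = d}. 1 / real ?q ^ (2 * degree P))
        \<le> (\<Sum>P\<in>(monics UNIV d :: 'a poly set). 1 / real ?q ^ (2 * d))"
      by (rule order.trans[OF _ sum_mono2])
         (auto simp: small_primes_def finite_monics_UNIV prime_poly_in_monics intro!: sum_mono)
    also have "\<dots> = 1 / real ?q ^ d"
      by (simp add: card_monics_UNIV mult_2 power_add)
    finally show "(\<Sum>P\<in>{P\<in>small_primes D. degree (P :: 'a poly) = d}. 1 / real ?q ^ (2 * degree P)) \<le> 1 / real ?q ^ d" .
  qed
  also have "\<dots> \<le> 1" using geometric_tail_le[OF two_le_CARD_field, where 'a1='a and D=0] by simp
  finally show ?thesis .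
qed

lemma prod_prime_squares_dvd_iff:
  fixes S :: "'a :: field_gcd poly set"
  assumes "finite S" "\<And>P. P \<in> S \<Longrightarrow> prime P"
  shows "(\<Prod>P\<in>S. P ^ 2) dvd f \<longleftrightarrow> (\<forall>P\<in>S. P ^ 2 dvd f)"
  using assms
proof (induction S rule: finite_induct)
  case (insert Q S)
  have "coprime (Q ^ 2) (\<Prod>P\<in>S. P ^ 2)"
  proof (rule prod_coprime_right)
    fix P assume "P \<in> S"
    then have "coprime Q P"
      using insert by (intro primes_coprime) auto
    then show "coprime (Q ^ 2) (P ^ 2)" by simp
  qed
  then show ?case
    using insert by (auto intro: divides_mult dest: dvd_mult_left dvd_mult_right)
qed simp

lemma degree_prod_squares:
  fixes S :: "'a :: field_gcd poly set"
  assumes "finite S" "\<And>P. P \<in> S \<Longrightarrow> prime P"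
  shows "degree (\<Prod>P\<in>S. P ^ 2) = (\<Sum>P\<in>S. 2 * degree P)" "lead_coeff (\<Prod>P\<in>S. P ^ 2) = 1"
proof -
  show "degree (\<Prod>P\<in>S. P ^ 2) = (\<Sum>P\<in>S. 2 * degree P)"
  proof (subst degree_prod_eq_sum_degree)
    have "P \<noteq> 0" if "P \<in> S" for P
      using assms(2)[OF that] by auto
    then show "\<forall>P\<in>S. P ^ 2 \<noteq> 0" and "(\<Sum>P\<in>S. degree (P ^ 2)) = (\<Sum>P\<in>S. 2 * degree P)"
      by (auto simp: degree_power_eq mult.commute)
  qed
  show "lead_coeff (\<Prod>P\<in>S. P ^ 2) = 1"
    using assms by (simp add: lead_coeff_prod lead_coeff_power lead_coeff_prime_poly)
qed

text \<open>The truncated expansion of the Euler product over the small primes; it depends only on the field,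
not on the family of polynomials to which the sieve is applied.\<close>

definition truncated_density :: "'a :: {finite, field_gcd} itself \<Rightarrow> nat \<Rightarrow> nat \<Rightarrow> real" where
  "truncated_density _ D r = (\<Sum>S | S \<subseteq> (small_primes D :: 'a poly set) \<and> card S < r.
      (-1) ^ card S * (\<Prod>P\<in>S. 1 / real CARD('a) ^ (2 * degree P)))"

text \<open>The sieve for an arbitrary finite family \<open>X\<close> in which divisibility by products of squares of
small primes has the expected probability up to \<open>\<eta>\<close>. The expected values of the omitted terms add
up to at most \<open>1 / r!\<close>, and the errors \<open>\<eta>\<close> are multiplied by the number of sets of at most \<open>r\<close> primes.\<close>

lemma sieve_approximation:
  fixes X :: "'a :: {finite, field_gcd} poly set"
  assumes "finite X" "\<eta> \<ge> 0"
    and approx: "\<And>S. S \<subseteq> small_primes D \<Longrightarrow> card S \<le> r \<Longrightarrow>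
      \<bar>real (card {f\<in>X. (\<Prod>P\<in>S. P ^ 2) dvd f}) - real (card X) / real CARD('a) ^ (\<Sum>P\<in>S. 2 * degree P)\<bar>
        \<le> real (card X) * \<eta>"
  shows "\<bar>real (card {f\<in>X. \<forall>P\<in>small_primes D. \<not> P ^ 2 dvd f}) - real (card X) * truncated_density TYPE('a) D r\<bar>
      \<le> real (card X) * (1 / fact r + real CARD('a) ^ (Suc D * r) * \<eta>)"
proof -
  let ?I = "small_primes D :: 'a poly set"
  let ?N = "real (card X)"
  let ?L = "{S. S \<subseteq> ?I \<and> card S < r}" and ?E = "{S. S \<subseteq> ?I \<and> card S = r}"
  define x where "x S = (\<Prod>P\<in>S. 1 / real CARD('a) ^ (2 * degree P))" for S :: "'a poly set"
  define c where "c S = real (card {f\<in>X. \<forall>P\<in>S. P ^ 2 dvd f})" for S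
  have finI: "finite ?I" by (rule finite_small_primes)
  have c_approx: "\<bar>c S - ?N * x S\<bar> \<le> ?N * \<eta>" if "S \<subseteq> ?I" "card S \<le> r" for S
  proof -
    have "finite S" "\<And>P. P \<in> S \<Longrightarrow> prime P"
      using that finI finite_subset by (auto simp: small_primes_def)
    then show ?thesis
      using approx[OF that]
      by (simp add: c_def x_def prod_prime_squares_dvd_iff prod_dividef power_sum)
  qed
  have bonf: "\<bar>real (card {f\<in>X. \<forall>P\<in>?I. \<not> P ^ 2 dvd f}) - (\<Sum>S\<in>?L. (-1) ^ card S * c S)\<bar> \<le> (\<Sum>S\<in>?E. c S)"
    unfolding c_def by (rule bonferroni_truncation[OF \<open>finite X\<close> finI])
  have "(\<Sum>S\<in>?E. c S) \<le> (\<Sum>S\<in>?E. ?N * x S + ?N * \<eta>)"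
  proof (rule sum_mono)
    fix S assume "S \<in> ?E"
    then have "\<bar>c S - ?N * x S\<bar> \<le> ?N * \<eta>" by (intro c_approx) auto
    then show "c S \<le> ?N * x S + ?N * \<eta>" by linarith
  qed
  also have "\<dots> = ?N * (\<Sum>S\<in>?E. x S) + card ?E * (?N * \<eta>)"
    by (simp add: sum.distrib sum_distrib_left)
  also have "(\<Sum>S\<in>?E. x S) \<le> (\<Sum>P\<in>?I. 1 / real CARD('a) ^ (2 * degree P)) ^ r / fact r"
    unfolding x_def by (rule elementary_symmetric_le[OF finI]) auto
  also have "\<dots> \<le> 1 / fact r"
    using sum_small_primes_le_1[where 'a='a and D=D] by (intro divide_right_mono power_le_one sum_nonneg) auto
  finally have E: "(\<Sum>S\<in>?E. c S) \<le> ?N * (1 / fact r) + card ?E * (?N * \<eta>)"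
    by (simp add: mult_left_mono)
  have "\<bar>(\<Sum>S\<in>?L. (-1) ^ card S * c S) - ?N * truncated_density TYPE('a) D r\<bar>
      = \<bar>\<Sum>S\<in>?L. (-1) ^ card S * (c S - ?N * x S)\<bar>"
    by (simp add: truncated_density_def x_def sum_distrib_left sum_subtractf algebra_simps)
  also have "\<dots> \<le> (\<Sum>S\<in>?L. ?N * \<eta>)"
    by (rule order.trans[OF sum_abs sum_mono]) (use c_approx in \<open>auto simp: abs_mult\<close>)
  finally have L: "\<bar>(\<Sum>S\<in>?L. (-1) ^ card S * c S) - ?N * truncated_density TYPE('a) D r\<bar> \<le> card ?L * (?N * \<eta>)"
    by simp
  have "?L \<union> ?E = {S. S \<subseteq> ?I \<and> card S \<le> r}" by auto
  then have "card ?L + card ?E = card {S. S \<subseteq> ?I \<and> card S \<le> r}"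
    using finI by (subst card_Un_disjoint[symmetric]) auto
  also have "\<dots> \<le> (card ?I + 1) ^ r" by (rule card_small_subsets_le[OF finI])
  also have "\<dots> \<le> (CARD('a) ^ Suc D) ^ r"
    using card_small_primes_less[of D, where 'a='a] by (intro power_mono) auto
  finally have "real (card ?L + card ?E) \<le> real ((CARD('a) ^ Suc D) ^ r)"
    by (rule of_nat_mono)
  then have "real (card ?L + card ?E) \<le> real CARD('a) ^ (Suc D * r)"
    by (simp only: of_nat_power power_mult)
  then have "real (card ?L + card ?E) * (?N * \<eta>) \<le> real CARD('a) ^ (Suc D * r) * (?N * \<eta>)"
    using \<open>\<eta> \<ge> 0\<close> by (intro mult_right_mono) auto
  then show ?thesis using bonf E L by (simp add: algebra_simps)
qed

lemma degree_prod_small_primes_le: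
  fixes S :: "'a :: {finite, field_gcd} poly set"
  assumes "S \<subseteq> small_primes D" "card S \<le> r"
  shows "(\<Sum>P\<in>S. 2 * degree P) \<le> 2 * r * D"
proof -
  have "(\<Sum>P\<in>S. 2 * degree P) \<le> (\<Sum>P\<in>S. 2 * D)"
    using assms by (intro sum_mono) (auto simp: small_primes_def)
  also have "\<dots> \<le> 2 * r * D" using assms by simp
  finally show ?thesis .
qed

lemma of_nat_power_diff:
  "q > 0 \<Longrightarrow> d \<le> n \<Longrightarrow> real (q ^ (n - d)) = real q ^ n / real q ^ d"
  unfolding of_nat_power by (rule power_diff) auto

lemma sieve_monics_UNIV:
  assumes "2 * r * D \<le> n"
  shows "\<bar>real (card {f\<in>monics UNIV n. \<forall>P\<in>small_primes D. \<not> P ^ 2 dvd (f :: 'a :: {finite, field_gcd} poly)})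
           - real CARD('a) ^ n * truncated_density TYPE('a) D r\<bar> \<le> real CARD('a) ^ n / fact r"
proof -
  have "\<bar>real (card {f\<in>monics UNIV n. \<forall>P\<in>small_primes D. \<not> P ^ 2 dvd (f :: 'a poly)})
           - real (card (monics UNIV n :: 'a poly set)) * truncated_density TYPE('a) D r\<bar>
      \<le> real (card (monics UNIV n :: 'a poly set)) * (1 / fact r + real CARD('a) ^ (Suc D * r) * 0)"
  proof (rule sieve_approximation)
    fix S :: "'a poly set" assume S: "S \<subseteq> small_primes D" "card S \<le> r"
    then have fin: "finite S" "\<And>P. P \<in> S \<Longrightarrow> prime P"
      using finite_small_primes finite_subset by (auto simp: small_primes_def)
    have le: "(\<Sum>P\<in>S. 2 * degree P) \<le> n"
      using degree_prod_small_primes_le[OF S] assms by simp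
    have "card {f\<in>monics UNIV n. (\<Prod>P\<in>S. P ^ 2) dvd f} = CARD('a) ^ (n - (\<Sum>P\<in>S. 2 * degree P))"
      using card_monics_dvd[of "\<Prod>P\<in>S. P ^ 2" n] degree_prod_squares[OF fin] le by metis
    then have "real (card {f\<in>monics UNIV n. (\<Prod>P\<in>S. P ^ 2) dvd f})
        = real CARD('a) ^ n / real CARD('a) ^ (\<Sum>P\<in>S. 2 * degree P)"
      using le by (simp only: of_nat_power_diff zero_less_card_finite)
    then show "\<bar>real (card {f\<in>monics UNIV n. (\<Prod>P\<in>S. P ^ 2) dvd f})
        - real (card (monics UNIV n :: 'a poly set)) / real CARD('a) ^ (\<Sum>P\<in>S. 2 * degree P)\<bar>
        \<le> real (card (monics UNIV n :: 'a poly set)) * 0"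
      by (simp add: card_monics_UNIV)
  qed (simp_all add: finite_monics_UNIV)
  then show ?thesis by (simp add: card_monics_UNIV)
qed

lemma sieve_monics_01:
  assumes rho: "0 < \<rho>" "\<rho> < 1" "\<And>x :: 'b :: prime_card mod_ring. x \<noteq> 0 \<Longrightarrow> norm (1 + additive_character x) \<le> 2 * \<rho>"
  shows "\<bar>real (card {f\<in>monics {0, 1} n. \<forall>P\<in>small_primes D. \<not> P ^ 2 dvd (f :: 'b mod_ring poly)})
           - 2 ^ n * truncated_density TYPE('b mod_ring) D r\<bar>
         \<le> 2 ^ n * (1 / fact r + real CARD('b) ^ (Suc D * r) * \<rho> ^ (n div (2 * r * D)))"
proof -
  let ?X = "monics {0, 1} n :: 'b mod_ring poly set"
  have "\<bar>real (card {f\<in>?X. \<forall>P\<in>small_primes D. \<not> P ^ 2 dvd f})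
           - real (card ?X) * truncated_density TYPE('b mod_ring) D r\<bar>
      \<le> real (card ?X) * (1 / fact r + real CARD('b mod_ring) ^ (Suc D * r) * \<rho> ^ (n div (2 * r * D)))"
  proof (rule sieve_approximation)
    fix S :: "'b mod_ring poly set" assume S: "S \<subseteq> small_primes D" "card S \<le> r"
    then have fin: "finite S" "\<And>P. P \<in> S \<Longrightarrow> prime P"
      using finite_small_primes finite_subset by (auto simp: small_primes_def)
    let ?M = "\<Prod>P\<in>S. P ^ 2"
    show "\<bar>real (card {f\<in>?X. ?M dvd f}) - real (card ?X) / real CARD('b mod_ring) ^ (\<Sum>P\<in>S. 2 * degree P)\<bar>
        \<le> real (card ?X) * \<rho> ^ (n div (2 * r * D))"
    proof (cases "S = {}")
      case False
      then have pos: "degree ?M > 0"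
      proof -
        have "0 < (\<Sum>P\<in>S. 2 * degree P)"
        proof (rule sum_pos)
          fix P assume "P \<in> S"
          then show "0 < 2 * degree P" using degree_prime_poly_pos[of P] fin by simp
        qed (use fin False in auto)
        then show ?thesis using degree_prod_squares[OF fin] by simp
      qed
      have "coprime P [:0, 1:]" if "P \<in> S" for P
        using that S fin prime_poly_X by (intro primes_coprime) (auto simp: small_primes_def)
      then have "coprime ?M [:0, 1:]"
        by (intro prod_coprime_left) auto
      then have "\<bar>real (card {f\<in>?X. ?M dvd f}) - 2 ^ n / CARD('b) ^ degree ?M\<bar> \<le> 2 ^ n * \<rho> ^ (n div degree ?M)"
        using equidistribution_01[OF rho(1,3) _ pos] by simp
      also have "n div (2 * r * D) \<le> n div degree ?M"
        using degree_prod_small_primes_le[OF S] degree_prod_squares[OF fin] pos by (intro div_le_mono2) auto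
      then have "2 ^ n * \<rho> ^ (n div degree ?M) \<le> 2 ^ n * \<rho> ^ (n div (2 * r * D))"
        using rho by (intro mult_left_mono power_decreasing) auto
      finally show ?thesis
        by (simp add: card_monics_01 degree_prod_squares[OF fin])
    qed (use rho in simp)
  qed (use rho in \<open>simp_all add: finite_monics\<close>)
  then show ?thesis by (simp add: card_monics_01)
qed

section \<open>Squarefree polynomials and polynomials that are squarefree away from the variable\<close>

text \<open>Squarefree up to a power of the variable.\<close>

definition squarefree_away :: "'a :: field_gcd poly \<Rightarrow> bool" where
  "squarefree_away f \<longleftrightarrow> (\<forall>P. prime P \<and> P \<noteq> [:0, 1:] \<longrightarrow> \<not> P ^ 2 dvd f)"

lemma squarefree_iff_squarefree_away:
  fixes f :: "'a :: field_gcd poly"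
  assumes "f \<noteq> 0"
  shows "squarefree f \<longleftrightarrow> squarefree_away f \<and> \<not> [:0, 1:] ^ 2 dvd f"
  using assms prime_poly_X by (auto simp: squarefree_factorial_semiring squarefree_away_def)

lemma squarefree_away_X_square_mult:
  "squarefree_away ([:0, 1:] ^ 2 * g) \<longleftrightarrow> squarefree_away (g :: 'a :: field_gcd poly)"
proof -
  have "P ^ 2 dvd [:0, 1:] ^ 2 * g \<longleftrightarrow> P ^ 2 dvd g" if "prime P" "P \<noteq> [:0, 1:]" for P :: "'a poly"
  proof -
    have "coprime P [:0, 1:]"
      using that prime_poly_X by (intro primes_coprime) auto
    then have "coprime (P ^ 2) ([:0, 1:] ^ 2)"
      by simp
    then show ?thesis
      by (simp add: coprime_dvd_mult_right_iff)
  qed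
  then show ?thesis by (auto simp: squarefree_away_def)
qed

lemma X_square_mult_in_monics_iff:
  fixes g :: "'a :: field poly"
  assumes "0 \<in> C"
  shows "[:0, 1:] ^ 2 * g \<in> monics C (n + 2) \<longleftrightarrow> g \<in> monics C n"
proof -
  have eq: "[:0, 1:] ^ 2 * g = pCons 0 (pCons 0 g)"
    by (simp add: power2_eq_square)
  show ?thesis
  proof (cases "g = 0")
    case False
    then show ?thesis
      using assms unfolding eq monics_def
      by (auto simp: coeff_pCons split: nat.splits)
  qed (auto simp: monics_def)
qed

text \<open>A polynomial that is squarefree away from \<open>t\<close> fails to be squarefree iff it is \<open>t\<^sup>2 g\<close>, and then \<open>g\<close>
is again squarefree away from \<open>t\<close>, with coefficients in the same set.\<close>

lemma card_squarefree_recursion: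
  fixes C :: "'a :: {finite, field_gcd} set"
  assumes "0 \<in> C"
  shows "card {f\<in>monics C (n + 2). squarefree f} + card {g\<in>monics C n. squarefree_away g}
       = card {f\<in>monics C (n + 2). squarefree_away f}"
proof -
  let ?t = "[:0, 1:] :: 'a poly"
  have nz: "f \<noteq> 0" if "f \<in> monics C m" for f m
    using that by (auto simp: monics_def)
  have img: "(\<lambda>g. ?t ^ 2 * g) ` {g\<in>monics C n. squarefree_away g}
      = {f\<in>monics C (n + 2). squarefree_away f \<and> ?t ^ 2 dvd f}"
    using X_square_mult_in_monics_iff[OF assms] squarefree_away_X_square_mult
    by (auto simp: image_iff elim!: dvdE)
  have inj: "inj_on (\<lambda>g. ?t ^ 2 * g) A" for A
    by (auto intro!: inj_onI)
  have "card {g\<in>monics C n. squarefree_away g} = card {f\<in>monics C (n + 2). squarefree_away f \<and> ?t ^ 2 dvd f}"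
    using card_image[OF inj] img by metis
  moreover have "{f\<in>monics C (n + 2). squarefree f} = {f\<in>monics C (n + 2). squarefree_away f \<and> \<not> ?t ^ 2 dvd f}"
    using squarefree_iff_squarefree_away nz by blast
  moreover have "{f\<in>monics C (n + 2). squarefree_away f}
      = {f\<in>monics C (n + 2). squarefree_away f \<and> \<not> ?t ^ 2 dvd f} \<union> {f\<in>monics C (n + 2). squarefree_away f \<and> ?t ^ 2 dvd f}"
    by blast
  ultimately show ?thesis
    using finite_monics[of C "n + 2"] by (simp add: card_Un_disjoint disjoint_iff)
qed

text \<open>At every prime the multiplicities satisfy \<open>2 * v A \<le> 2 * v A' + 1\<close>, so \<open>v A \<le> v A'\<close>.\<close>

lemma square_times_squarefree_unique:
  fixes A B :: "'a :: field_gcd poly"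
  assumes "A ^ 2 * B = A' ^ 2 * B'" "squarefree B'" "A' \<noteq> 0"
  shows "A dvd A'"
proof -
  have "B' \<noteq> 0" using assms by auto
  then have nz: "A \<noteq> 0" using assms by auto
  show ?thesis
  proof (rule multiplicity_le_imp_dvd[OF nz])
    fix P :: "'a poly" assume P: "prime P"
    have "A ^ 2 dvd A' ^ 2 * B'" using assms(1) by (metis dvd_triv_left)
    then have "multiplicity P (A ^ 2) \<le> multiplicity P (A' ^ 2 * B')"
      using \<open>B' \<noteq> 0\<close> assms(3) by (intro dvd_imp_multiplicity_le) auto
    then have "2 * multiplicity P A \<le> 2 * multiplicity P A' + multiplicity P B'"
      using P nz \<open>B' \<noteq> 0\<close> assms(3)
      by (simp add: prime_elem_multiplicity_mult_distrib prime_elem_multiplicity_power_distrib)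
    moreover have "multiplicity P B' \<le> 1"
      using assms(2) P \<open>B' \<noteq> 0\<close> by (simp add: squarefree_factorial_semiring'')
    ultimately show "multiplicity P A \<le> multiplicity P A'" by linarith
  qed
qed

lemma bij_betw_square_times_squarefree:
  "bij_betw (\<lambda>(k, A, B). A ^ 2 * B)
     (SIGMA k:{..n div 2}. monics UNIV k \<times> {B\<in>monics UNIV (n - 2 * k). squarefree B})
     (monics UNIV n :: 'a :: field_gcd poly set)"
  unfolding bij_betw_def
proof (intro conjI inj_onI equalityI subsetI)
  fix x y :: "nat \<times> 'a poly \<times> 'a poly"
  assume x: "x \<in> (SIGMA k:{..n div 2}. monics UNIV k \<times> {B\<in>monics UNIV (n - 2 * k). squarefree B})"
    and y: "y \<in> (SIGMA k:{..n div 2}. monics UNIV k \<times> {B\<in>monics UNIV (n - 2 * k). squarefree B})"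
    and eq: "(\<lambda>(k, A, B). A ^ 2 * B) x = (\<lambda>(k, A, B). A ^ 2 * B) y"
  obtain k A B where xe: "x = (k, A, B)" by (cases x)
  obtain k' A' B' where ye: "y = (k', A', B')" by (cases y)
  have A: "A \<noteq> 0" "A' \<noteq> 0" "lead_coeff A = 1" "lead_coeff A' = 1"
    using x y by (auto simp: xe ye monics_def)
  have "A dvd A'" "A' dvd A"
    using x y eq A by (auto simp: xe ye intro: square_times_squarefree_unique[of A B A' B'] square_times_squarefree_unique[of A' B' A B])
  then have "A = A'" using A by (metis poly_dvd_antisym)
  moreover from this have "B = B'" using eq A by (simp add: xe ye)
  ultimately show "x = y" using x y by (auto simp: xe ye monics_def)
next
  fix f :: "'a poly"
  assume "f \<in> (\<lambda>(k, A, B). A ^ 2 * B) ` (SIGMA k:{..n div 2}. monics UNIV k \<times> {B\<in>monics UNIV (n - 2 * k). squarefree B})"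
  then obtain k A B where f: "f = A ^ 2 * B" "k \<le> n div 2" "A \<in> monics UNIV k" "B \<in> monics UNIV (n - 2 * k)"
    by auto
  then have "A \<noteq> 0" "B \<noteq> 0" by (auto simp: monics_def)
  then have "degree f = n" using f by (auto simp: monics_def degree_mult_eq degree_power_eq)
  moreover have "lead_coeff f = 1"
    using f(3,4) unfolding f(1) lead_coeff_mult lead_coeff_power by (auto simp: monics_def)
  ultimately show "f \<in> monics UNIV n" by (simp add: monics_def)
next
  fix f :: "'a poly" assume f: "f \<in> monics UNIV n"
  then have nz: "f \<noteq> 0" by (auto simp: monics_def)
  define A B where "A = square_part f" and "B = squarefree_part f"
  have dec: "f = A ^ 2 * B"
    unfolding A_def B_def by (subst squarefree_decompose[of f]) (simp add: mult.commute)
  have AB: "A \<noteq> 0" "B \<noteq> 0" using nz dec by auto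
  have A1: "lead_coeff A = 1"
    using AB by (intro lead_coeff_normalized_poly) (simp_all add: A_def)
  have deg: "n = 2 * degree A + degree B"
    using f dec AB by (simp add: monics_def degree_mult_eq degree_power_eq)
  have "lead_coeff B = 1"
    using f A1 unfolding dec monics_def by (simp add: lead_coeff_mult lead_coeff_power degree_mult_eq)
  then have "(degree A, A, B) \<in> (SIGMA k:{..n div 2}. monics UNIV k \<times> {B\<in>monics UNIV (n - 2 * k). squarefree B})"
    using A1 deg by (auto simp: monics_def B_def)
  then show "f \<in> (\<lambda>(k, A, B). A ^ 2 * B) ` (SIGMA k:{..n div 2}. monics UNIV k \<times> {B\<in>monics UNIV (n - 2 * k). squarefree B})"
    using dec by (intro image_eqI[of _ _ "(degree A, A, B)"]) auto
qed

text \<open>Sorting the \<open>q^n\<close> monic polynomials \<open>A\<^sup>2 B\<close> by the degree \<open>k\<close> of \<open>A\<close> gives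
\<open>q^n = (\<Sum>k. q^k * s (n - 2 k))\<close>; the terms with \<open>k > 0\<close> are \<open>q\<close> times the same sum for \<open>n - 2\<close>.\<close>

lemma card_squarefree_monics_UNIV:
  "card {f\<in>monics UNIV (n + 2). squarefree (f :: 'a :: {finite, field_gcd} poly)} + CARD('a) ^ (n + 1) = CARD('a) ^ (n + 2)"
proof -
  let ?q = "CARD('a)"
  define s where "s n = card {f\<in>monics UNIV n. squarefree (f :: 'a poly)}" for n
  have total: "?q ^ n = (\<Sum>k\<le>n div 2. ?q ^ k * s (n - 2 * k))" for n
  proof -
    have "?q ^ n = card (monics UNIV n :: 'a poly set)" by (simp add: card_monics_UNIV)
    also have "\<dots> = card (SIGMA k:{..n div 2}. (monics UNIV k :: 'a poly set) \<times> {B\<in>monics UNIV (n - 2 * k). squarefree (B :: 'a poly)})"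
      by (rule bij_betw_same_card[OF bij_betw_square_times_squarefree, symmetric])
    also have "\<dots> = (\<Sum>k\<le>n div 2. ?q ^ k * s (n - 2 * k))"
      by (subst card_SigmaI) (auto simp: finite_monics card_cartesian_product card_monics_UNIV s_def)
    finally show ?thesis .
  qed
  have "?q ^ (n + 2) = (\<Sum>k\<le>Suc (n div 2). ?q ^ k * s (n + 2 - 2 * k))"
    using total[of "n + 2"] by simp
  also have "\<dots> = s (n + 2) + (\<Sum>k\<le>n div 2. ?q ^ Suc k * s (n - 2 * k))"
    by (subst sum.atMost_Suc_shift) simp
  also have "(\<Sum>k\<le>n div 2. ?q ^ Suc k * s (n - 2 * k)) = ?q * ?q ^ n"
    by (subst total[of n]) (simp add: sum_distrib_left mult.assoc)
  finally show ?thesis by (simp add: s_def)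
qed

lemma card_squarefree_away_monics_UNIV:
  fixes n :: nat
  defines "U \<equiv> \<lambda>n. card {f\<in>monics UNIV n. squarefree_away (f :: 'a :: {finite, field_gcd} poly)}"
  shows "U n * (CARD('a) + 1) = CARD('a) ^ (n + 1) + (if even n then 1 else CARD('a))"
proof (induction n rule: nat_induct2)
  have small: "U n = CARD('a) ^ n" if "n \<le> 1" for n
  proof -
    have "squarefree_away f" if f: "f \<in> monics UNIV n" for f :: "'a poly"
      unfolding squarefree_away_def
    proof (intro allI impI notI, elim conjE)
      fix P :: "'a poly" assume P: "prime P" "P ^ 2 dvd f"
      have "f \<noteq> 0" using f by (auto simp: monics_def)
      then have "degree (P ^ 2) \<le> degree f" using P by (intro dvd_imp_degree_le)
      moreover have "degree (P ^ 2) = 2 * degree P" using P by (subst degree_power_eq) auto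
      ultimately show False
        using f \<open>n \<le> 1\<close> degree_prime_poly_pos[OF P(1)] by (auto simp: monics_def)
    qed
    then have "{f\<in>monics UNIV n. squarefree_away f} = (monics UNIV n :: 'a poly set)" by blast
    then show ?thesis by (simp add: U_def card_monics_UNIV)
  qed
  show "U 0 * (CARD('a) + 1) = CARD('a) ^ (0 + 1) + (if even 0 then 1 else CARD('a))"
    by (simp add: small)
  show "U 1 * (CARD('a) + 1) = CARD('a) ^ (1 + 1) + (if even 1 then 1 else CARD('a))"
    by (simp add: small power2_eq_square)
next
  fix n assume IH: "U n * (CARD('a) + 1) = CARD('a) ^ (n + 1) + (if even n then 1 else CARD('a))"
  have "card {f\<in>monics UNIV (n + 2). squarefree (f :: 'a poly)} + U n = U (n + 2)"
    unfolding U_def by (rule card_squarefree_recursion) simp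
  then have "U (n + 2) + CARD('a) ^ (n + 1) = CARD('a) ^ (n + 2) + U n"
    using card_squarefree_monics_UNIV[of n, where 'a='a] by linarith
  then have "(U (n + 2) + CARD('a) ^ (n + 1)) * (CARD('a) + 1) = (CARD('a) ^ (n + 2) + U n) * (CARD('a) + 1)"
    by simp
  then have "U (n + 2) * (CARD('a) + 1) + CARD('a) ^ (n + 2) + CARD('a) ^ (n + 1)
      = CARD('a) ^ (n + 3) + CARD('a) ^ (n + 2) + U n * (CARD('a) + 1)"
    by (simp add: algebra_simps numeral_3_eq_3)
  then show "U (n + 2) * (CARD('a) + 1) = CARD('a) ^ (n + 2 + 1) + (if even (n + 2) then 1 else CARD('a))"
    unfolding IH by (simp add: numeral_3_eq_3)
qed

lemma card_large_prime_square_monics_UNIV: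
  "real (card {f\<in>monics UNIV n. \<exists>P. prime P \<and> degree P > D \<and> P ^ 2 dvd (f :: 'a :: {finite, field_gcd} poly)})
     \<le> real CARD('a) ^ n / real CARD('a) ^ D"
proof -
  let ?q = "CARD('a)"
  define W where "W P = {f\<in>monics UNIV n. P ^ 2 dvd f}" for P :: "'a poly"
  have W: "real (card (W P)) \<le> real ?q ^ n / real ?q ^ (2 * d)" if P: "P \<in> monics UNIV d" for P d
  proof -
    have nz: "P \<noteq> 0" using P by (auto simp: monics_def)
    have deg: "degree (P ^ 2) = 2 * d" "lead_coeff (P ^ 2) = 1"
      using P nz unfolding lead_coeff_power by (auto simp: monics_def degree_power_eq)
    show ?thesis
    proof (cases "2 * d \<le> n")
      case True
      have "card (W P) = CARD('a) ^ (n - 2 * d)"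
        using card_monics_dvd[of "P ^ 2" n] deg True unfolding W_def by metis
      then show ?thesis using True by (simp only: of_nat_power_diff zero_less_card_finite)
    next
      case False
      have "W P = {}"
      proof (rule ccontr)
        assume "W P \<noteq> {}"
        then obtain f where f: "f \<in> monics UNIV n" "P ^ 2 dvd f" by (auto simp: W_def)
        then have "degree (P ^ 2) \<le> degree f"
          by (intro dvd_imp_degree_le) (auto simp: monics_def)
        then show False using f deg False by (simp add: monics_def)
      qed
      then show ?thesis by simp
    qed
  qed
  have finW: "finite (W P)" for P by (simp add: W_def finite_monics)
  have "{f\<in>monics UNIV n. \<exists>P. prime P \<and> degree P > D \<and> P ^ 2 dvd (f :: 'a poly)}
      \<subseteq> (\<Union>d\<in>{D<..n}. \<Union>P\<in>monics UNIV d. W P)"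
  proof (clarify)
    fix f P :: "'a poly" assume f: "f \<in> monics UNIV n" and P: "prime P" "D < degree P" "P ^ 2 dvd f"
    have "P dvd f" using P(3) by (metis dvd_mult_left power2_eq_square)
    then have "degree P \<le> n" using f by (auto simp: monics_def intro!: dvd_imp_degree_le)
    then show "f \<in> (\<Union>d\<in>{D<..n}. \<Union>P\<in>monics UNIV d. W P)"
      using f P prime_poly_in_monics[OF P(1)] by (auto simp: W_def)
  qed
  then have "card {f\<in>monics UNIV n. \<exists>P. prime P \<and> degree P > D \<and> P ^ 2 dvd (f :: 'a poly)}
      \<le> card (\<Union>d\<in>{D<..n}. \<Union>P\<in>monics UNIV d. W P)"
    by (intro card_mono) (auto simp: finite_monics finW)
  also have "\<dots> \<le> (\<Sum>d\<in>{D<..n}. card (\<Union>P\<in>monics UNIV d. W P))"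
    by (intro card_UN_le) simp
  also have "\<dots> \<le> (\<Sum>d\<in>{D<..n}. \<Sum>P\<in>monics UNIV d. card (W P))"
    by (intro sum_mono card_UN_le finite_monics)
  finally have "real (card {f\<in>monics UNIV n. \<exists>P. prime P \<and> degree P > D \<and> P ^ 2 dvd (f :: 'a poly)})
      \<le> (\<Sum>d\<in>{D<..n}. \<Sum>P\<in>monics UNIV d. real (card (W P)))"
    by (simp flip: of_nat_sum)
  also have "\<dots> \<le> (\<Sum>d\<in>{D<..n}. \<Sum>P\<in>(monics UNIV d :: 'a poly set). real ?q ^ n / real ?q ^ (2 * d))"
    by (intro sum_mono W)
  also have "\<dots> = real ?q ^ n * (\<Sum>d\<in>{D<..n}. 1 / real ?q ^ d)"
    by (simp add: card_monics_UNIV mult_2 power_add sum_distrib_left)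
  also have "\<dots> \<le> real ?q ^ n * (1 / real ?q ^ D)"
    by (intro mult_left_mono geometric_tail_le two_le_CARD_field) auto
  finally show ?thesis by simp
qed

text \<open>The sieve for all monic polynomials of some degree \<open>n\<close>, read backwards: the number of
polynomials that are squarefree away from \<open>t\<close> is known, and this evaluates the main term.\<close>

lemma truncated_density_approx:
  assumes "2 * r * D \<le> n"
  shows "\<bar>truncated_density TYPE('a :: {finite, field_gcd}) D r - 1 / (1 + 1 / real CARD('a))\<bar>
     \<le> 1 / fact r + 1 / real CARD('a) ^ D + 1 / real CARD('a) ^ n"
proof -
  let ?q = "CARD('a)"
  let ?G = "{f\<in>monics UNIV n. squarefree_away (f :: 'a poly)}"
  let ?H = "{f\<in>monics UNIV n. \<forall>P\<in>small_primes D. \<not> P ^ 2 dvd (f :: 'a poly)}"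
  let ?B = "{f\<in>monics UNIV n. \<exists>P. prime P \<and> degree P > D \<and> P ^ 2 dvd (f :: 'a poly)}"
  have q: "?q \<ge> 2" by (rule two_le_CARD_field)
  have fin: "finite ?G" "finite ?H" "finite ?B" by (simp_all add: finite_monics)
  have GH: "?G \<subseteq> ?H" "?H \<subseteq> ?G \<union> ?B"
    by (auto simp: squarefree_away_def small_primes_def) (metis not_le)
  then have "card ?G \<le> card ?H" "card ?H \<le> card ?G + card ?B"
    using fin card_mono[of ?H ?G] card_mono[of "?G \<union> ?B" ?H] card_Un_le[of ?G ?B] by auto
  then have GH': "\<bar>real (card ?H) - real (card ?G)\<bar> \<le> real ?q ^ n / real ?q ^ D"
    using card_large_prime_square_monics_UNIV[of n D, where 'a='a] by linarith
  have H: "\<bar>real (card ?H) - real ?q ^ n * truncated_density TYPE('a) D r\<bar> \<le> real ?q ^ n / fact r"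
    using sieve_monics_UNIV[OF assms] by simp
  define e where "e = (if even n then 1 else ?q)"
  have "card ?G * (?q + 1) = ?q ^ (n + 1) + e"
    unfolding e_def by (rule card_squarefree_away_monics_UNIV)
  then have "real (card ?G) * (real ?q + 1) = real ?q ^ (n + 1) + real e"
    by (metis of_nat_1 of_nat_add of_nat_mult of_nat_power)
  then have "real (card ?G) = (real ?q ^ (n + 1) + real e) / (real ?q + 1)"
    by (simp add: field_simps)
  then have "real (card ?G) - real ?q ^ n * (1 / (1 + 1 / real ?q)) = real e / (real ?q + 1)"
    using q by (simp add: field_simps)
  moreover have "0 \<le> real e / (real ?q + 1)" "real e / (real ?q + 1) \<le> 1"
    by (auto simp: e_def)
  ultimately have G: "\<bar>real (card ?G) - real ?q ^ n * (1 / (1 + 1 / real ?q))\<bar> \<le> 1"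
    by linarith
  have "\<bar>real ?q ^ n * truncated_density TYPE('a) D r - real ?q ^ n * (1 / (1 + 1 / real ?q))\<bar>
      \<le> real ?q ^ n / fact r + real ?q ^ n / real ?q ^ D + 1"
    using GH' H G by linarith
  also have "real ?q ^ n * truncated_density TYPE('a) D r - real ?q ^ n * (1 / (1 + 1 / real ?q))
      = real ?q ^ n * (truncated_density TYPE('a) D r - 1 / (1 + 1 / real ?q))"
    by (simp only: right_diff_distrib)
  also have "\<bar>\<dots>\<bar> = real ?q ^ n * \<bar>truncated_density TYPE('a) D r - 1 / (1 + 1 / real ?q)\<bar>"
    by (simp add: abs_mult)
  finally have "real ?q ^ n * \<bar>truncated_density TYPE('a) D r - 1 / (1 + 1 / real ?q)\<bar>
      \<le> real ?q ^ n * (1 / fact r + 1 / real ?q ^ D + 1 / real ?q ^ n)"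
    by (simp add: distrib_left)
  then show ?thesis
    by (rule mult_left_le_imp_le) simp
qed

section \<open>Squares of primes of large degree\<close>

text \<open>The product of the distinct prime divisors divides \<open>g\<close>; the proof squares both sides in order to reuse
\<open>prod_prime_squares_dvd_iff\<close>.\<close>

lemma card_prime_divisors_le_degree:
  fixes g :: "'a :: field_gcd poly"
  assumes "g \<noteq> 0"
  shows "finite {P. prime P \<and> P dvd g}" "card {P. prime P \<and> P dvd g} \<le> degree g"
proof -
  let ?S = "{P. prime P \<and> P dvd g}"
  have eq: "?S = prime_factors g" using assms by (auto simp: prime_factors_dvd)
  show fin: "finite ?S" unfolding eq by simp
  have "(\<Prod>P\<in>?S. P ^ 2) dvd g ^ 2"
    using fin by (subst prod_prime_squares_dvd_iff) auto
  then have "degree (\<Prod>P\<in>?S. P ^ 2) \<le> degree (g ^ 2)"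
    using assms by (intro dvd_imp_degree_le) auto
  then have "(\<Sum>P\<in>?S. 2 * degree P) \<le> 2 * degree g"
    using assms degree_prod_squares(1)[OF fin] by (simp add: degree_power_eq)
  moreover have "(\<Sum>P\<in>?S. 2 * 1) \<le> (\<Sum>P\<in>?S. 2 * degree P)"
    using degree_prime_poly_pos by (intro sum_mono) (auto simp: Suc_le_eq)
  ultimately show "card ?S \<le> degree g" by simp
qed

lemma indicator_poly_Frobenius:
  fixes R :: "nat set"
  assumes "finite R" "\<And>i. i \<in> R \<Longrightarrow> CARD('b) dvd i"
  shows "indicator_poly R = (indicator_poly {j. CARD('b) * j \<in> R} :: 'b :: prime_card mod_ring poly) ^ CARD('b)"
proof -
  let ?p = "CARD('b)"
  have p: "prime ?p" by (rule prime_card)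
  have R: "R = (\<lambda>j. ?p * j) ` {j. ?p * j \<in> R}"
    using assms(2) by (auto elim!: dvdE)
  have inj: "inj_on (\<lambda>j. ?p * j) A" for A using p by (auto intro!: inj_onI)
  have "(indicator_poly {j. ?p * j \<in> R} :: 'b mod_ring poly) ^ ?p
      = (\<Sum>j | ?p * j \<in> R. Polynomial.monom 1 j ^ ?p)"
    unfolding indicator_poly_def by (rule freshmans_dream_sum) (use p in auto)
  also have "\<dots> = (\<Sum>j | ?p * j \<in> R. Polynomial.monom 1 (?p * j))"
    by (simp add: monom_power mult.commute)
  also have "\<dots> = indicator_poly R"
    unfolding indicator_poly_def by (subst (2) R) (simp add: sum.reindex[OF inj])
  finally show ?thesis ..
qed

lemma pderiv_indicator_poly_multiples:
  assumes "\<And>i. i \<in> R \<Longrightarrow> CARD('b) dvd i"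
  shows "pderiv (indicator_poly R :: 'b :: prime_card mod_ring poly) = 0"
proof -
  have "pderiv (indicator_poly R :: 'b mod_ring poly) = (\<Sum>i\<in>R. pderiv (Polynomial.monom 1 i))"
    unfolding indicator_poly_def using higher_pderiv_sum[of 1] by simp
  also have "\<dots> = 0"
  proof (rule sum.neutral, rule ballI)
    fix i assume "i \<in> R"
    then have "of_nat i = (0 :: 'b mod_ring)"
      using assms by (simp add: of_nat_eq_0_iff_char_dvd)
    then show "pderiv (Polynomial.monom 1 i :: 'b mod_ring poly) = 0"
      by (simp add: pderiv_monom)
  qed
  finally show ?thesis .
qed

text \<open>The polynomials \<open>indicator_poly R\<close> are \<open>p\<close>-th powers \<open>h R ^ p\<close>. If \<open>R\<close> and \<open>R'\<close> both satisfy the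
condition then \<open>P\<close> divides \<open>(h R - h R') ^ p\<close>, hence \<open>h R - h R'\<close>; if they also agree
at the exponents from \<open>p * D\<close> on, this difference has degree less than \<open>D\<close> and is therefore zero.
So \<open>R\<close> is determined by its part above \<open>p * D\<close>.\<close>

lemma card_subsets_of_multiples_dvd:
  fixes P c :: "'b :: prime_card mod_ring poly" and n D :: nat
  defines "B \<equiv> {i\<in>{..<n}. CARD('b) dvd i}"
  assumes P: "prime P" "D \<le> degree P" and n: "CARD('b) * D \<le> n"
  shows "card {R\<in>Pow B. P dvd c + indicator_poly R} \<le> 2 ^ (card B - D)"
proof -
  let ?p = "CARD('b)"
  let ?X = "{R\<in>Pow B. P dvd c + indicator_poly R}"
  have p: "prime ?p" by (rule prime_card)
  have finB: "finite B" by (simp add: B_def)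
  define h where "h R = (indicator_poly {j. ?p * j \<in> R} :: 'b mod_ring poly)" for R
  have finh: "finite {j. ?p * j \<in> R}" if "finite R" for R
    using finite_vimageI[OF that, of "\<lambda>j. ?p * j"] p by (auto simp: vimage_def inj_on_def)
  have inj: "inj_on (\<lambda>R. R \<inter> {?p * D..}) ?X"
  proof (rule inj_onI)
    fix R R' assume R: "R \<in> ?X" and R': "R' \<in> ?X" and eq: "R \<inter> {?p * D..} = R' \<inter> {?p * D..}"
    have fin: "finite R" "finite R'" using R R' finB finite_subset by auto
    have pow: "indicator_poly R = h R ^ ?p" "indicator_poly R' = h R' ^ ?p"
      unfolding h_def using fin R R' by (auto intro!: indicator_poly_Frobenius simp: B_def)
    have "P dvd (c + indicator_poly R) - (c + indicator_poly R')"
      using R R' by (intro dvd_diff) auto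
    then have "P dvd h R ^ ?p - h R' ^ ?p" by (simp add: pow)
    moreover have "(h R - h R' + h R') ^ ?p = (h R - h R') ^ ?p + h R' ^ ?p"
      by (rule freshmans_dream) (use p in auto)
    ultimately have "P dvd (h R - h R') ^ ?p" by simp
    then have dvd: "P dvd h R - h R'"
      using P(1) prime_dvd_power by blast
    have "?p * j \<in> R \<longleftrightarrow> ?p * j \<in> R'" if "j \<ge> D" for j
    proof -
      have "?p * j \<in> {?p * D..}" using that by simp
      then show ?thesis using eq by blast
    qed
    then have "h R - h R' \<in> polys_below D"
      using finh fin by (simp add: polys_below_def h_def coeff_indicator_poly)
    then have "h R - h R' = 0"
      using polys_below_dvd_imp_0 dvd P(2) by blast
    then have "indicator_poly R = (indicator_poly R' :: 'b mod_ring poly)" by (simp add: pow)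
    then have "poly.coeff (indicator_poly R) i = poly.coeff (indicator_poly R' :: 'b mod_ring poly) i" for i
      by simp
    then have "i \<in> R \<longleftrightarrow> i \<in> R'" for i
      using fin by (metis coeff_indicator_poly zero_neq_one)
    then show "R = R'" by blast
  qed
  have low: "B \<inter> {..<?p * D} = (\<lambda>j. ?p * j) ` {..<D}"
    using n p by (auto simp: B_def elim!: dvdE) (metis less_le_trans mult_less_mono2 neq0_conv not_prime_0)
  have "card (B \<inter> {..<?p * D}) = D"
    unfolding low using p by (subst card_image) (auto simp: inj_on_def)
  moreover have "B \<inter> {?p * D..} = B - (B \<inter> {..<?p * D})" by auto
  ultimately have card: "card (B \<inter> {?p * D..}) = card B - D"
    using finB by (simp add: card_Diff_subset)
  have "card ?X \<le> card (Pow (B \<inter> {?p * D..}))"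
    using finB by (intro card_inj_on_le[OF inj]) auto
  also have "\<dots> = 2 ^ (card B - D)" using finB card by (subst card_Pow) auto
  finally show ?thesis .
qed

text \<open>Split the exponents below \<open>n\<close> into the set \<open>B\<close> of multiples of \<open>p\<close> and the rest \<open>A\<close>. The part \<open>T\<close>
of the support of \<open>f\<close> inside \<open>A\<close> determines \<open>f'\<close>. If \<open>f' \<noteq> 0\<close>, the prime \<open>P\<close> is one of its
at most \<open>n\<close> monic prime divisors and \<open>card_subsets_of_multiples_dvd\<close> bounds the number of parts in \<open>B\<close>.
The derivative can vanish only for empty \<open>T\<close>, where the trivial bound \<open>2 ^ card B\<close> is good enough
because \<open>A\<close> has at least \<open>D\<close> elements.\<close>

lemma card_large_prime_square_monics_01:
  assumes n: "CARD('b) * D \<le> n"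
  shows "card {f\<in>monics {0, 1} n. \<exists>P. prime P \<and> degree P > D \<and> P ^ 2 dvd (f :: 'b :: prime_card mod_ring poly)}
     \<le> (n + 1) * 2 ^ (n - D)"
proof -
  let ?p = "CARD('b)"
  have p: "prime ?p" by (rule prime_card)
  define A B where "A = {i\<in>{..<n}. \<not> ?p dvd i}" and "B = {i\<in>{..<n}. ?p dvd i}"
  define F where "F S = (indicator_poly (insert n S) :: 'b mod_ring poly)" for S
  define Q where "Q f \<longleftrightarrow> (\<exists>P. prime P \<and> degree P > D \<and> P ^ 2 dvd (f :: 'b mod_ring poly))" for f
  define G where "G T = {R\<in>Pow B. Q (F (T \<union> R))}" for T
  have fin: "finite A" "finite B" and AB: "A \<union> B = {..<n}" "A \<inter> B = {}"
    by (auto simp: A_def B_def)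
  have cAB: "card A + card B = n"
    using card_Un_disjoint[OF fin AB(2)] AB(1) by simp
  have "(\<lambda>j. ?p * j) ` {..<D} \<subseteq> B" "(\<lambda>j. ?p * j + 1) ` {..<D} \<subseteq> A"
  proof -
    have lt: "?p * j + 1 < ?p * D" if "j < D" for j
    proof -
      have "?p * (j + 1) \<le> ?p * D" using that by (intro mult_le_mono) auto
      then show ?thesis using prime_gt_1_nat[OF p] by (simp add: algebra_simps)
    qed
    have "\<not> ?p dvd ?p * j + 1" for j
      using prime_gt_1_nat[OF p] by (metis dvd_add_right_iff dvd_triv_left nat_dvd_1_iff_1 less_irrefl)
    then show "(\<lambda>j. ?p * j) ` {..<D} \<subseteq> B" "(\<lambda>j. ?p * j + 1) ` {..<D} \<subseteq> A"
      using lt n by (fastforce simp: A_def B_def)+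
  qed
  then have "card ((\<lambda>j. ?p * j) ` {..<D}) \<le> card B" "card ((\<lambda>j. ?p * j + 1) ` {..<D}) \<le> card A"
    using fin by (auto intro: card_mono)
  then have D: "D \<le> card B" "D \<le> card A"
    using p by (simp_all add: card_image inj_on_def)
  have F_split: "F (T \<union> R) = F T + indicator_poly R" if "T \<subseteq> A" "R \<subseteq> B" for T R
  proof -
    have "finite T" "finite R" using that fin finite_subset by blast+
    moreover have "insert n T \<inter> R = {}" using that AB by (auto simp: B_def A_def)
    ultimately show ?thesis
      unfolding F_def using indicator_poly_Un_disjoint[of "insert n T" R] by simp
  qed
  have pderiv_F: "pderiv (F (T \<union> R)) = pderiv (F T)" if "T \<subseteq> A" "R \<subseteq> B" for T R
  proof -
    have "pderiv (indicator_poly R :: 'b mod_ring poly) = 0"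
      using that by (intro pderiv_indicator_poly_multiples) (auto simp: B_def)
    then show ?thesis using F_split[OF that] by (simp add: pderiv_add)
  qed
  have G_le: "card (G T) \<le> n * 2 ^ (card B - D)" if T: "T \<subseteq> A" "pderiv (F T) \<noteq> 0" for T
  proof -
    let ?S = "{P. prime P \<and> P dvd pderiv (F T)}"
    have S: "finite ?S" "card ?S \<le> degree (pderiv (F T))"
      using card_prime_divisors_le_degree[OF T(2)] by auto
    have "finite T" using T fin finite_subset by blast
    have "degree (F T) \<le> n"
      unfolding F_def using T(1) \<open>finite T\<close> by (intro degree_le) (auto simp: coeff_indicator_poly A_def)
    then have "degree (pderiv (F T)) \<le> n"
      by (intro degree_le) (auto simp: coeff_pderiv coeff_eq_0)
    have sub: "G T \<subseteq> (\<Union>P\<in>{P\<in>?S. D \<le> degree P}. {R\<in>Pow B. P dvd F T + indicator_poly R})"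
    proof
      fix R assume "R \<in> G T"
      then obtain P where R: "R \<subseteq> B" and P: "prime P" "degree P > D" "P ^ 2 dvd F (T \<union> R)"
        by (auto simp: G_def Q_def)
      obtain k where "F (T \<union> R) = P ^ 2 * k" using P(3) by (elim dvdE)
      then have k: "F (T \<union> R) = P * (P * k)" by (simp add: power2_eq_square mult.assoc)
      have "pderiv (F (T \<union> R)) = P * pderiv (P * k) + P * k * pderiv P"
        unfolding k by (rule pderiv_mult)
      then have "P dvd pderiv (F T)"
        using pderiv_F[OF T(1) R] by (metis dvd_add dvd_triv_left mult.assoc)
      moreover have "P dvd F T + indicator_poly R"
        using k F_split[OF T(1) R] by (metis dvd_triv_left)
      ultimately show "R \<in> (\<Union>P\<in>{P\<in>?S. D \<le> degree P}. {R\<in>Pow B. P dvd F T + indicator_poly R})"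
        using P R by auto
    qed
    have fX: "finite {R\<in>Pow B. X R}" for X
      by (rule finite_subset[of _ "Pow B"]) (use fin in auto)
    have "card (G T) \<le> card (\<Union>P\<in>{P\<in>?S. D \<le> degree P}. {R\<in>Pow B. P dvd F T + indicator_poly R})"
      by (intro card_mono[OF _ sub] finite_UN_I fX finite_subset[OF _ S(1)]) auto
    also have "\<dots> \<le> (\<Sum>P\<in>{P\<in>?S. D \<le> degree P}. card {R\<in>Pow B. P dvd F T + indicator_poly R})"
      by (intro card_UN_le finite_subset[OF _ S(1)]) auto
    also have "\<dots> \<le> (\<Sum>P\<in>{P\<in>?S. D \<le> degree P}. 2 ^ (card B - D))"
      unfolding B_def using n by (intro sum_mono card_subsets_of_multiples_dvd) auto
    also have "\<dots> = card {P\<in>?S. D \<le> degree P} * 2 ^ (card B - D)" by simp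
    also have "card {P\<in>?S. D \<le> degree P} \<le> card ?S"
      using S by (intro card_mono) auto
    also have "card ?S \<le> n"
      using S \<open>degree (pderiv (F T)) \<le> n\<close> by linarith
    finally show ?thesis by simp
  qed
  have nonzero: "pderiv (F T) \<noteq> 0" if T: "T \<subseteq> A" "T \<noteq> {}" for T
  proof
    assume zero: "pderiv (F T) = 0"
    obtain i where i: "i \<in> T" using T by auto
    have "\<not> ?p dvd i" using i T by (auto simp: A_def)
    then obtain l where l: "i = Suc l" by (cases i) auto
    have "finite T" using T fin finite_subset by blast
    have "poly.coeff (pderiv (F T)) l = of_nat i"
      using i \<open>finite T\<close> unfolding coeff_pderiv F_def l[symmetric] by (simp add: coeff_indicator_poly)
    then have "of_nat i = (0 :: 'b mod_ring)" using zero by simp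
    then show False
      using \<open>\<not> ?p dvd i\<close> by (simp add: of_nat_eq_0_iff_char_dvd)
  qed
  have finG: "finite (G T)" for T using fin by (simp add: G_def)
  have "card {f\<in>monics {0, 1} n. Q f} \<le> card (\<Union>T\<in>Pow A. (\<lambda>R. F (T \<union> R)) ` G T)"
  proof (intro card_mono finite_UN_I finite_imageI finG)
    show "{f \<in> monics {0, 1} n. Q f} \<subseteq> (\<Union>T\<in>Pow A. (\<lambda>R. F (T \<union> R)) ` G T)"
    proof
      fix f assume f: "f \<in> {f \<in> monics {0, 1} n. Q f}"
      then obtain S where S: "S \<subseteq> {..<n}" "f = F S"
        using bij_betw_imp_surj_on[OF bij_betw_monics_01[of n, where 'a="'b mod_ring"]] by (auto simp: F_def)
      have "S = (S \<inter> A) \<union> (S \<inter> B)" using S AB by blast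
      then have "S \<inter> B \<in> G (S \<inter> A)" "f = F ((S \<inter> A) \<union> (S \<inter> B))" using f S by (auto simp: G_def)
      then show "f \<in> (\<Union>T\<in>Pow A. (\<lambda>R. F (T \<union> R)) ` G T)" by blast
    qed
  qed (use fin in auto)
  also have "\<dots> \<le> (\<Sum>T\<in>Pow A. card ((\<lambda>R. F (T \<union> R)) ` G T))"
    using fin by (intro card_UN_le) auto
  also have "\<dots> \<le> (\<Sum>T\<in>Pow A. card (G T))"
    by (intro sum_mono card_image_le finG)
  also have "\<dots> = card (G {}) + (\<Sum>T\<in>Pow A - {{}}. card (G T))"
    using fin by (intro sum.remove) auto
  also have "(\<Sum>T\<in>Pow A - {{}}. card (G T)) \<le> (\<Sum>T\<in>Pow A - {{}}. n * 2 ^ (card B - D))"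
    by (intro sum_mono G_le nonzero) auto
  also have "\<dots> \<le> (\<Sum>T\<in>Pow A. n * 2 ^ (card B - D))"
    using fin by (intro sum_mono2) auto
  also have "\<dots> = n * 2 ^ (card A + (card B - D))"
    using fin by (simp add: card_Pow power_add)
  also have "card (G {}) \<le> card (Pow B)"
    using fin by (intro card_mono) (auto simp: G_def)
  also have "card (Pow B) \<le> 2 ^ (n - D)"
    using fin D cAB by (simp add: card_Pow)
  finally show ?thesis
    using D cAB by (simp add: Q_def)
qed

section \<open>From a finite field to its prime field\<close>

lemma CHAR_eq_if_card_prime_power:
  assumes "prime p" "CARD('a :: finite_field) = p ^ k"
  shows "CHAR('a) = p"
proof -
  have "(\<Sum>x\<in>(UNIV :: 'a set). x) = (\<Sum>x\<in>UNIV. x + 1)"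
    by (rule sum.reindex_bij_witness[of _ "\<lambda>x. x + 1" "\<lambda>x. x - 1"]) auto
  then have "of_nat CARD('a) = (0 :: 'a)" by (simp add: sum.distrib)
  then have "CHAR('a) dvd p ^ k"
    unfolding of_nat_eq_0_iff_char_dvd assms(2) .
  have prime: "prime CHAR('a)" by auto
  show ?thesis
    by (rule primes_dvd_imp_eq[OF prime assms(1) prime_dvd_power[OF prime \<open>CHAR('a) dvd p ^ k\<close>]])
qed

text \<open>The type \<open>'a ring_char\<close> has \<open>CHAR('a)\<close> elements, so \<open>'a ring_char mod_ring\<close> is a copy of the prime
field of \<open>'a\<close>.\<close>

definition prime_field_embedding :: "'a :: finite_field ring_char mod_ring \<Rightarrow> 'a" where
  "prime_field_embedding x = of_int (to_int_mod_ring x)"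

lemma to_int_mod_ring_1 [simp]: "to_int_mod_ring (1 :: 'b :: prime_card mod_ring) = 1"
  by transfer simp

lemma field_hom_prime_field_embedding: "field_hom (prime_field_embedding :: 'a :: finite_field ring_char mod_ring \<Rightarrow> 'a)"
proof
  show "prime_field_embedding (x + y) = prime_field_embedding x + (prime_field_embedding y :: 'a)" for x y
    unfolding prime_field_embedding_def to_int_mod_ring_add CARD_ring_char of_int_mod_CHAR by simp
  show "prime_field_embedding (x * y) = prime_field_embedding x * (prime_field_embedding y :: 'a)" for x y
    unfolding prime_field_embedding_def to_int_mod_ring_mult CARD_ring_char of_int_mod_CHAR by simp
  show "prime_field_embedding 0 = (0 :: 'a)" "prime_field_embedding 1 = (1 :: 'a)"
    by (simp_all add: prime_field_embedding_def to_int_mod_ring_hom.hom_zero)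
qed

lemma map_poly_embedding_indicator_poly:
  assumes "finite S"
  shows "map_poly prime_field_embedding (indicator_poly S) = (indicator_poly S :: 'a :: finite_field poly)"
proof -
  interpret field_hom "prime_field_embedding :: 'a ring_char mod_ring \<Rightarrow> 'a"
    by (rule field_hom_prime_field_embedding)
  show ?thesis
    by (intro poly_eqI) (simp add: coeff_indicator_poly assms)
qed

lemma power_CARD_mod_ring: "x ^ CARD('b) = (x :: 'b :: prime_card mod_ring)"
  using finite_field_power_card_eq_same[of x] by simp

text \<open>A polynomial with derivative zero only involves powers of \<open>t^p\<close>, and its coefficients are their
own \<open>p\<close>-th powers.\<close>

lemma pderiv_eq_0_imp_power:
  fixes P :: "'b :: prime_card mod_ring poly"
  assumes "pderiv P = 0"
  shows "\<exists>Q. P = Q ^ CARD('b)"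
proof -
  let ?p = "CARD('b)"
  have p: "prime ?p" by (rule prime_card)
  have zero: "poly.coeff P i = 0" if i: "\<not> ?p dvd i" for i
  proof -
    obtain l where l: "i = Suc l" using i by (cases i) auto
    have "of_nat i * poly.coeff P i = poly.coeff (pderiv P) l"
      unfolding l by (simp add: coeff_pderiv)
    then show ?thesis using i assms by (simp add: of_nat_eq_0_iff_char_dvd)
  qed
  define Q where "Q = (\<Sum>j\<le>degree P. Polynomial.monom (poly.coeff P (?p * j)) j)"
  have "Q ^ ?p = (\<Sum>j\<le>degree P. Polynomial.monom (poly.coeff P (?p * j)) j ^ ?p)"
    unfolding Q_def by (rule freshmans_dream_sum) (use p in auto)
  also have "\<dots> = (\<Sum>j\<le>degree P. Polynomial.monom (poly.coeff P (?p * j)) (?p * j))"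
    by (simp add: monom_power power_CARD_mod_ring mult.commute)
  also have "\<dots> = P"
  proof (rule poly_eqI)
    fix i
    have "poly.coeff (\<Sum>j\<le>degree P. Polynomial.monom (poly.coeff P (?p * j)) (?p * j)) i
        = (\<Sum>j\<le>degree P. if ?p * j = i then poly.coeff P i else 0)"
      unfolding coeff_sum by (intro sum.cong) auto
    also have "\<dots> = poly.coeff P i"
    proof (cases "?p dvd i \<and> i \<le> degree P")
      case True
      then obtain l where l: "i = ?p * l" by blast
      have "l \<le> ?p * l" using prime_gt_0_nat[OF p] by simp
      then have "l \<le> degree P" using True unfolding l by linarith
      have "(\<Sum>j\<le>degree P. if ?p * j = i then poly.coeff P i else 0) = (\<Sum>j\<le>degree P. if j = l then poly.coeff P i else 0)"
        using p by (intro sum.cong) (auto simp: l)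
      then show ?thesis using \<open>l \<le> degree P\<close> by simp
    next
      case False
      then have "poly.coeff P i = 0" using zero coeff_eq_0[of P i] by auto
      then show ?thesis by (simp cong: if_cong)
    qed
    finally show "poly.coeff (\<Sum>j\<le>degree P. Polynomial.monom (poly.coeff P (?p * j)) (?p * j)) i = poly.coeff P i" .
  qed
  finally show ?thesis by metis
qed

text \<open>A common prime divisor \<open>P\<close> of \<open>f = P k\<close> and \<open>f'\<close> divides \<open>k P'\<close>. It cannot divide \<open>k\<close>, so it
divides \<open>P'\<close>, which has smaller degree and hence vanishes; but then \<open>P\<close> is a \<open>p\<close>-th power.\<close>

lemma coprime_pderiv_if_squarefree:
  fixes f :: "'b :: prime_card mod_ring poly"
  assumes "squarefree f"
  shows "coprime f (pderiv f)"
proof (rule ccontr)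
  assume "\<not> coprime f (pderiv f)"
  have nz: "f \<noteq> 0" using assms by auto
  have "\<not> is_unit (gcd f (pderiv f))" using \<open>\<not> coprime f (pderiv f)\<close> by (simp only: is_unit_gcd not_False_eq_True)
  moreover have "gcd f (pderiv f) \<noteq> 0" using nz by simp
  ultimately obtain P where P: "P dvd gcd f (pderiv f)" "prime P"
    using prime_divisor_exists by blast
  have "P dvd f" "P dvd pderiv f"
    by (rule dvd_trans[OF P(1) gcd_dvd1], rule dvd_trans[OF P(1) gcd_dvd2])
  from \<open>P dvd f\<close> obtain k where k: "f = P * k" by (elim dvdE)
  have "P dvd P * pderiv k + k * pderiv P"
    using \<open>P dvd pderiv f\<close> unfolding k pderiv_mult .
  then have "P dvd k * pderiv P" by (simp add: dvd_add_right_iff)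
  then have "P dvd k \<or> P dvd pderiv P"
    using P(2) by (simp add: prime_dvd_mult_iff)
  moreover have "\<not> P dvd k"
  proof
    assume "P dvd k"
    then have "P ^ 2 dvd f" unfolding k power2_eq_square by (rule mult_dvd_mono[OF dvd_refl])
    then show False using assms P(2) not_prime_unit squarefreeD by blast
  qed
  moreover have "\<not> P dvd pderiv P"
  proof
    assume "P dvd pderiv P"
    have "degree P > 0" by (rule degree_prime_poly_pos[OF P(2)])
    have "pderiv P \<in> polys_below (degree P)"
      by (auto simp: polys_below_def coeff_pderiv coeff_eq_0)
    then have "pderiv P = 0"
      using \<open>P dvd pderiv P\<close> polys_below_dvd_imp_0 by blast
    then obtain Q where Q: "P = Q ^ CARD('b)" using pderiv_eq_0_imp_power by blast
    have "CARD('b) \<ge> 2" using prime_card[where 'a='b] by (rule prime_ge_2_nat)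
    then have "Q ^ 2 dvd P" unfolding Q by (rule le_imp_power_dvd)
    then have "Q dvd 1" using squarefree_prime[OF P(2)] squarefreeD by blast
    then have "is_unit P"
      unfolding Q using dvd_power_same[of Q 1 "CARD('b)"] by (simp only: power_one)
    then show False using P(2) not_prime_unit by blast
  qed
  ultimately show False by blast
qed

text \<open>Divisibility by a square is inherited by the larger field, and the Bezout identity between \<open>f\<close>
and \<open>f'\<close>, which excludes square factors, also persists there.\<close>

lemma squarefree_map_poly_embedding_iff:
  fixes f :: "'a :: finite_field ring_char mod_ring poly"
  shows "squarefree (map_poly (prime_field_embedding :: _ \<Rightarrow> 'a) f) \<longleftrightarrow> squarefree f"
proof
  interpret field_hom "prime_field_embedding :: 'a ring_char mod_ring \<Rightarrow> 'a"
    by (rule field_hom_prime_field_embedding)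
  interpret mp: map_poly_idom_hom "prime_field_embedding :: 'a ring_char mod_ring \<Rightarrow> 'a" ..
  let ?m = "map_poly (prime_field_embedding :: _ \<Rightarrow> 'a)"
  {
    assume sq: "squarefree (?m f)"
    show "squarefree f"
    proof (rule squarefreeI)
      fix x assume "x ^ 2 dvd f"
      then have "?m (x ^ 2) dvd ?m f" by (rule mp.hom_dvd)
      then have "?m x ^ 2 dvd ?m f" unfolding mp.hom_power .
      then have "?m x dvd 1" by (rule squarefreeD[OF sq])
      then have "degree x = 0" "?m x \<noteq> 0" using is_unit_iff_degree[of "?m x"] by (auto simp: degree_map_poly)
      then show "x dvd 1" using is_unit_iff_degree[of x] by auto
    qed
  next
    assume "squarefree f"
    then have "coprime f (pderiv f)" by (rule coprime_pderiv_if_squarefree)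
    then obtain u v where uv: "u * f + v * pderiv f = 1"
      using bezout_coefficients_fst_snd[of f "pderiv f"] unfolding coprime_imp_gcd_eq_1[OF \<open>coprime f (pderiv f)\<close>] by blast
    have "?m u * ?m f + ?m v * pderiv (?m f) = 1"
      using arg_cong[OF uv, of ?m] by (simp add: mp.hom_mult mp.hom_add map_poly_pderiv)
    show "squarefree (?m f)"
    proof (rule squarefreeI)
      fix x assume "x ^ 2 dvd ?m f"
      then obtain k where "?m f = x ^ 2 * k" by (elim dvdE)
      then have k: "?m f = x * (x * k)" by (simp add: power2_eq_square mult.assoc)
      have "x dvd ?m f" unfolding k by simp
      moreover have "x dvd pderiv (?m f)" unfolding k pderiv_mult by (intro dvd_add) auto
      ultimately show "x dvd 1"
        unfolding \<open>?m u * ?m f + ?m v * pderiv (?m f) = 1\<close>[symmetric] by (intro dvd_add dvd_mult)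
    qed
  }
qed

lemma card_squarefree_01_prime_field:
  "card {f\<in>monics {0, 1 :: 'a :: finite_field} n. squarefree f}
     = card {f\<in>monics {0, 1 :: 'a ring_char mod_ring} n. squarefree f}"
proof -
  have "card {f\<in>monics {0, 1 :: 'a} n. squarefree f}
      = card {S\<in>Pow {..<n}. squarefree (indicator_poly (insert n S) :: 'a poly)}"
    using bij_betw_monics_01[of n, where 'a='a]
    by (intro bij_betw_same_card[symmetric] bij_betw_Collect) auto
  also have "\<dots> = card {S\<in>Pow {..<n}. squarefree (indicator_poly (insert n S) :: 'a ring_char mod_ring poly)}"
  proof (rule arg_cong[of _ _ card], rule Collect_cong, rule conj_cong[OF refl])
    fix S assume "S \<in> Pow {..<n}"
    then have "finite (insert n S)" using finite_subset by auto
    then show "squarefree (indicator_poly (insert n S) :: 'a poly)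
        = squarefree (indicator_poly (insert n S) :: 'a ring_char mod_ring poly)"
      using squarefree_map_poly_embedding_iff[where 'a='a and f="indicator_poly (insert n S)"]
        map_poly_embedding_indicator_poly[where 'a='a and S="insert n S"] by simp
  qed
  also have "\<dots> = card {f\<in>monics {0, 1 :: 'a ring_char mod_ring} n. squarefree f}"
    using bij_betw_monics_01[of n, where 'a="'a ring_char mod_ring"]
    by (intro bij_betw_same_card bij_betw_Collect) auto
  finally show ?thesis .
qed

section \<open>Choice of the sieve parameters\<close>

lemma power_div_fact_le_exp:
  assumes "(z :: real) \<ge> 0"
  shows "z ^ r / fact r \<le> exp z"
proof -
  have "(\<Sum>n\<in>{r}. z ^ n /\<^sub>R fact n) \<le> (\<Sum>n. z ^ n /\<^sub>R fact n)"
    using assms by (intro sum_le_suminf summable_exp_generic) auto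
  then show ?thesis by (simp add: exp_def field_simps)
qed

text \<open>One factor \<open>2^(q w) \<ge> q^w\<close> of the denominator provides the saving, the other one,
\<open>2^(q w) \<ge> 4^w \<ge> exp w\<close>, absorbs \<open>n < w^4\<close>.\<close>

lemma linear_over_exponential_le:
  assumes "q \<ge> 2" "n < w ^ 4"
  shows "real (n + 1) / 2 ^ (2 * q * w) \<le> 25 / real q ^ w"
proof -
  have "real w ^ 4 / fact 4 \<le> exp (real w)" by (rule power_div_fact_le_exp) simp
  also have "exp (real w) = exp 1 ^ w" by (simp flip: exp_of_nat_mult)
  also have "exp 1 ^ w \<le> (4 :: real) ^ w" using exp_le by (intro power_mono) auto
  finally have "real w ^ 4 \<le> 24 * 4 ^ w" by (simp add: fact_numeral)
  moreover have "real (n + 1) \<le> real (w ^ 4)" using assms(2) by (intro of_nat_mono) simp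
  ultimately have "real (n + 1) \<le> 24 * 4 ^ w" by simp
  moreover have "(0::real) \<le> 4 ^ w" by simp
  ultimately have num: "real (n + 1) \<le> 25 * 4 ^ w" by linarith
  have "(4::real) ^ w \<le> (2 ^ q) ^ w"
    using power_increasing[of 2 q "2::real"] assms(1) by (intro power_mono) auto
  moreover have "real q ^ w \<le> (2 ^ q) ^ w"
    using less_exp[of q] by (intro power_mono) (auto simp: less_imp_le of_nat_less_two_power)
  ultimately have "(4::real) ^ w * real q ^ w \<le> (2 ^ q) ^ w * (2 ^ q) ^ w"
    by (intro mult_mono) auto
  also have "\<dots> = 2 ^ (2 * q * w)"
    by (simp flip: power_mult power_add)
  finally have den: "(4::real) ^ w * real q ^ w \<le> 2 ^ (2 * q * w)" .
  have "real (n + 1) * real q ^ w \<le> 25 * 4 ^ w * real q ^ w"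
    using num by (intro mult_right_mono) auto
  also have "\<dots> \<le> 25 * 2 ^ (2 * q * w)" using den by simp
  finally show ?thesis using assms(1) by (simp add: field_simps)
qed

lemma fourth_root_bracket:
  assumes "b > 0" "b ^ 4 \<le> n"
  obtains r :: nat where "r \<ge> 1" "(b * r) ^ 4 \<le> n" "n < (b * (r + 1)) ^ 4"
proof -
  let ?P = "\<lambda>r. (b * r) ^ 4 \<le> n"
  have bound: "r \<le> n" if "?P r" for r
  proof (rule ccontr)
    assume "\<not> r \<le> n"
    then have "n < r" by simp
    also have "r \<le> b * r" using assms(1) by simp
    also have "b * r \<le> (b * r) ^ 4" using \<open>n < r\<close> assms(1) by (intro self_le_power) (auto simp: Suc_le_eq)
    finally show False using that by simp
  qed
  define r where "r = (GREATEST r. ?P r)"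
  have P1: "?P 1" using assms by simp
  have "?P r" unfolding r_def by (rule GreatestI_nat[of ?P 1 n]) (use P1 bound in auto)
  moreover have "1 \<le> r" unfolding r_def by (rule Greatest_le_nat[of ?P 1 n]) (use P1 bound in auto)
  moreover have "\<not> ?P (r + 1)"
  proof
    assume "?P (r + 1)"
    then have "r + 1 \<le> r" unfolding r_def by (rule Greatest_le_nat[of ?P _ n]) (use bound in auto)
    then show False by simp
  qed
  ultimately show ?thesis using that[of r] by (auto simp: not_le)
qed

text \<open>With \<open>b r \<le> n^(1/4) < b (r + 1)\<close> and \<open>w = b (r + 1)\<close> it suffices to bound each term by a constant
times \<open>q^-w\<close>. The degree bound \<open>D = 2 q w\<close> makes \<open>2^D\<close> beat \<open>n q^w\<close> in the last term. Then
\<open>2 r D\<close> is at most \<open>8 q b r\<^sup>2\<close>, so the exponent of \<open>\<rho>\<close> is at least of order \<open>b^3 r\<^sup>2\<close>, whereas the exponent of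
\<open>q\<close> in front is of order \<open>b r\<^sup>2\<close>: a large constant \<open>b\<close> makes the exponential saving win.\<close>

lemma sieve_parameters:
  fixes q :: nat and \<rho> :: real
  assumes q: "q \<ge> 2" and rho: "0 < \<rho>" "\<rho> < 1"
  obtains K :: real and N :: nat where "K \<ge> 0" and
    "\<And>n. n \<ge> N \<Longrightarrow> \<exists>r D. 2 * r * D \<le> n \<and> q * D \<le> n \<and>
       2 / fact r + real q ^ (Suc D * r) * \<rho> ^ (n div (2 * r * D)) + 1 / real q ^ D + 1 / real q ^ n
         + real (n + 1) / 2 ^ D \<le> K * real q powr (- (real n powr (1/4)))"
proof -
  obtain c where c: "\<rho> ^ c < 1 / real q ^ (5 * q + 2)"
    using real_arch_pow_inv[of "1 / real q ^ (5 * q + 2)" \<rho>] q rho by auto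
  \<comment> \<open>The factor \<open>8 q\<close> cancels the one in \<open>2 r D \<le> 8 q b r\<^sup>2\<close>, so that the exponent of \<open>\<rho>\<close> needs no rounding.\<close>
  define b where "b = 8 * q * Suc c"
  have b: "b \<ge> 16" "8 * q \<le> b" using q by (auto simp: b_def)
  \<comment> \<open>The summands belong to the five error terms in their order.\<close>
  define K where "K = 2 * (real q ^ b * exp (real q ^ b)) + 1 + 1 + 1 + 25"
  have step: "\<exists>r D. 2 * r * D \<le> n \<and> q * D \<le> n \<and>
       2 / fact r + real q ^ (Suc D * r) * \<rho> ^ (n div (2 * r * D)) + 1 / real q ^ D + 1 / real q ^ n
         + real (n + 1) / 2 ^ D \<le> K * real q powr (- (real n powr (1/4)))" if n: "n \<ge> b ^ 4" for n
  proof -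
    obtain r where r: "r \<ge> 1" "(b * r) ^ 4 \<le> n" "n < (b * (r + 1)) ^ 4"
      using fourth_root_bracket[of b n] b n by auto
    define w where "w = b * (r + 1)"
    define D where "D = 2 * q * w"
    have w2: "w \<le> 2 * b * r" using r(1) by (simp add: w_def algebra_simps)
    have D_le: "D \<le> 4 * q * b * r" using mult_left_mono[OF w2, of "2 * q"] by (simp add: D_def algebra_simps)
    have "2 * r * D \<le> 2 * r * (4 * q * b * r)" using D_le by (intro mult_left_mono) auto
    then have rD: "2 * r * D \<le> 8 * q * b * r ^ 2" by (simp add: power2_eq_square algebra_simps)
    have cn: "(b ^ 2 * Suc c * r ^ 2) * (8 * q * b * r ^ 2) \<le> n"
    proof -
      have "(b ^ 2 * Suc c * r ^ 2) * (8 * q * b * r ^ 2) = b ^ 3 * (8 * q * Suc c) * r ^ 4"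
        by (simp add: power2_eq_square power3_eq_cube power4_eq_xxxx algebra_simps)
      also have "\<dots> = (b * r) ^ 4"
        unfolding b_def[symmetric] by (simp add: power3_eq_cube power4_eq_xxxx algebra_simps)
      finally show ?thesis using r(2) by simp
    qed
    have "1 \<le> b ^ 2 * Suc c * r ^ 2" using b r(1) by (simp add: Suc_le_eq)
    then have "1 * (8 * q * b * r ^ 2) \<le> (b ^ 2 * Suc c * r ^ 2) * (8 * q * b * r ^ 2)"
      by (intro mult_right_mono) auto
    then have cond1: "2 * r * D \<le> n" using rD cn by linarith
    have "q * D \<le> q * (4 * q * b * r)" using D_le by (rule mult_left_mono) simp
    also have "\<dots> \<le> b * (b * b * r)"
      using b by (intro mult_mono) auto
    also have "\<dots> = b ^ 3 * r" by (simp add: power3_eq_cube)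
    also have "\<dots> \<le> b ^ 4 * r ^ 4"
      using b r(1) by (intro mult_mono power_increasing self_le_power) auto
    also have "\<dots> \<le> n" using r(2) by (simp add: power_mult_distrib)
    finally have cond2: "q * D \<le> n" .
    have wD: "w \<le> D" using q by (simp add: D_def)
    have Dn: "D \<le> n" using cond2 q by (metis le_trans mult_le_mono1 nat_mult_1 one_le_numeral)
    have t1: "2 / fact r \<le> 2 * (real q ^ b * exp (real q ^ b)) * (1 / real q ^ w)"
    proof -
      have "(real q ^ b) ^ r / fact r \<le> exp (real q ^ b)" by (rule power_div_fact_le_exp) simp
      then have "real q ^ b * ((real q ^ b) ^ r / fact r) \<le> real q ^ b * exp (real q ^ b)"
        by (intro mult_left_mono) auto
      then have "real q ^ w / fact r \<le> real q ^ b * exp (real q ^ b)"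
        by (simp add: w_def power_mult power_add)
      then show ?thesis using q by (simp add: field_simps)
    qed
    have t2: "real q ^ (Suc D * r) * \<rho> ^ (n div (2 * r * D)) \<le> 1 * (1 / real q ^ w)"
    proof -
      have D0: "2 * r * D > 0" using q r(1) b by (simp add: D_def w_def)
      have "(b ^ 2 * Suc c * r ^ 2) * (2 * r * D) \<le> n"
        using cn rD by (meson le_trans mult_le_mono2)
      then have "b ^ 2 * Suc c * r ^ 2 \<le> n div (2 * r * D)"
        using D0 by (simp add: less_eq_div_iff_mult_less_eq)
      moreover have "c * (b * r ^ 2) \<le> b ^ 2 * Suc c * r ^ 2"
      proof -
        have "c * (b * r ^ 2) \<le> (b * Suc c) * (b * r ^ 2)" using mult_le_mono1[of 1 b "Suc c"] b by (intro mult_right_mono) auto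
        then show ?thesis by (simp add: power2_eq_square algebra_simps)
      qed
      ultimately have "c * (b * r ^ 2) \<le> n div (2 * r * D)" by linarith
      then have "\<rho> ^ (n div (2 * r * D)) \<le> \<rho> ^ (c * (b * r ^ 2))"
        using rho by (intro power_decreasing) auto
      also have "\<dots> = (\<rho> ^ c) ^ (b * r ^ 2)" by (simp add: power_mult)
      also have "\<dots> \<le> (1 / real q ^ (5 * q + 2)) ^ (b * r ^ 2)"
        using c rho by (intro power_mono) auto
      also have "\<dots> = 1 / real q ^ ((5 * q + 2) * (b * r ^ 2))"
        by (simp only: power_one_over power_mult)
      finally have rho_le: "\<rho> ^ (n div (2 * r * D)) \<le> 1 / real q ^ ((5 * q + 2) * (b * r ^ 2))" .
      have "Suc D * r + w \<le> (5 * q + 2) * (b * r ^ 2)"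
      proof -
        have "Suc D * r \<le> (5 * q * b * r) * r"
        proof (rule mult_right_mono)
          have "1 \<le> q * b * r" using q b r(1) by (simp add: Suc_le_eq)
          then show "Suc D \<le> 5 * q * b * r" using D_le by linarith
        qed simp
        moreover have "w \<le> 2 * b * r * r" using w2 r(1) by (metis le_trans mult.right_neutral mult_le_mono2)
        ultimately show ?thesis by (simp add: power2_eq_square algebra_simps)
      qed
      then have "real q ^ (Suc D * r) * real q ^ w \<le> real q ^ ((5 * q + 2) * (b * r ^ 2))"
        unfolding power_add[symmetric] using q by (intro power_increasing) auto
      moreover have "real q ^ (Suc D * r) * \<rho> ^ (n div (2 * r * D))
          \<le> real q ^ (Suc D * r) * (1 / real q ^ ((5 * q + 2) * (b * r ^ 2)))"
        using rho_le by (intro mult_left_mono) auto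
      moreover have "real q ^ (Suc D * r) * (1 / real q ^ ((5 * q + 2) * (b * r ^ 2))) \<le> 1 / real q ^ w"
        if "real q ^ (Suc D * r) * real q ^ w \<le> real q ^ ((5 * q + 2) * (b * r ^ 2))"
        using that q by (simp add: divide_simps)
      ultimately show ?thesis by linarith
    qed
    have mono: "1 / real q ^ m \<le> 1 * (1 / real q ^ w)" if "w \<le> m" for m
      using that q by (simp add: frac_le power_increasing)
    have t5: "real (n + 1) / 2 ^ D \<le> 25 * (1 / real q ^ w)"
      using linear_over_exponential_le[OF q, of n w] r(3) by (simp add: D_def w_def)
    have "2 / fact r + real q ^ (Suc D * r) * \<rho> ^ (n div (2 * r * D)) + 1 / real q ^ D + 1 / real q ^ n
         + real (n + 1) / 2 ^ D \<le> K * (1 / real q ^ w)"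
      using t1 t2 mono[OF wD] mono[of n] wD Dn t5 unfolding K_def distrib_right by linarith
    also have "\<dots> \<le> K * real q powr (- (real n powr (1/4)))"
    proof (rule mult_left_mono)
      have "real n \<le> real (w ^ 4)" using r(3) unfolding w_def by (intro of_nat_mono) simp
      then have "real n \<le> real w ^ 4" by simp
      then have "real n powr (1/4) \<le> (real w ^ 4) powr (1/4)" by (intro powr_mono2) auto
      also have "\<dots> = real w" by (cases "w = 0") (auto simp: powr_powr simp flip: powr_numeral)
      finally have "real q powr (- real w) \<le> real q powr (- (real n powr (1/4)))"
        using q by (intro powr_mono) auto
      then show "1 / real q ^ w \<le> real q powr (- (real n powr (1/4)))"
        using q powr_realpow[of "real q" w] by (simp only: powr_minus_divide)
    qed (simp add: K_def)
    finally show ?thesis using cond1 cond2 by blast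
  qed
  show ?thesis by (rule that[of K "b ^ 4"]) (use step in \<open>auto simp: K_def\<close>)
qed

section \<open>Counting squarefree polynomials with coefficients 0 and 1\<close>

lemma squarefree_away_01_approx:
  fixes n r D :: nat
  defines "p \<equiv> CARD('b :: prime_card)"
  assumes rho: "0 < \<rho>" "\<rho> < 1" "\<And>x :: 'b mod_ring. x \<noteq> 0 \<Longrightarrow> norm (1 + additive_character x) \<le> 2 * \<rho>"
    and small: "2 * r * D \<le> n" "p * D \<le> n"
  shows "\<bar>real (card {f\<in>monics {0, 1} n. squarefree_away (f :: 'b mod_ring poly)}) - 2 ^ n * (1 / (1 + 1 / real p))\<bar>
     \<le> 2 ^ n * (2 / fact r + real p ^ (Suc D * r) * \<rho> ^ (n div (2 * r * D)) + 1 / real p ^ D + 1 / real p ^ n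
          + real (n + 1) / 2 ^ D)"
proof -
  let ?G = "{f\<in>monics {0, 1} n. squarefree_away (f :: 'b mod_ring poly)}"
  let ?H = "{f\<in>monics {0, 1} n. \<forall>P\<in>small_primes D. \<not> P ^ 2 dvd (f :: 'b mod_ring poly)}"
  let ?B = "{f\<in>monics {0, 1} n. \<exists>P. prime P \<and> degree P > D \<and> P ^ 2 dvd (f :: 'b mod_ring poly)}"
  let ?t = "truncated_density TYPE('b mod_ring) D r"
  have fin: "finite ?G" "finite ?H" "finite ?B" by (simp_all add: finite_monics)
  have GH: "?G \<subseteq> ?H" "?H \<subseteq> ?G \<union> ?B"
    by (auto simp: squarefree_away_def small_primes_def) (metis not_le)
  then have "card ?G \<le> card ?H" "card ?H \<le> card ?G + card ?B"
    using fin card_mono[of ?H ?G] card_mono[of "?G \<union> ?B" ?H] card_Un_le[of ?G ?B] by auto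
  moreover have "real (card ?B) \<le> 2 ^ n * (real (n + 1) / 2 ^ D)"
  proof -
    have "D \<le> p * D" using prime_gt_0_nat[OF prime_card[where 'a='b]] by (simp add: p_def)
    then have "D \<le> n" using small(2) by linarith
    have "real (card ?B) \<le> real ((n + 1) * 2 ^ (n - D))"
      using small(2) unfolding p_def by (intro of_nat_mono card_large_prime_square_monics_01)
    also have "\<dots> = real (n + 1) * (2 ^ n / 2 ^ D)"
      using \<open>D \<le> n\<close> by (simp only: of_nat_mult of_nat_power_diff zero_less_numeral of_nat_numeral)
    finally show ?thesis by (simp add: mult.commute)
  qed
  moreover have "\<bar>real (card ?H) - 2 ^ n * ?t\<bar>
      \<le> 2 ^ n * (1 / fact r + real p ^ (Suc D * r) * \<rho> ^ (n div (2 * r * D)))"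
    unfolding p_def by (rule sieve_monics_01[OF rho])
  moreover have "\<bar>2 ^ n * ?t - 2 ^ n * (1 / (1 + 1 / real p))\<bar>
      \<le> 2 ^ n * (1 / fact r + 1 / real p ^ D + 1 / real p ^ n)"
  proof -
    have "\<bar>?t - 1 / (1 + 1 / real p)\<bar> \<le> 1 / fact r + 1 / real p ^ D + 1 / real p ^ n"
      using truncated_density_approx[OF small(1), where 'a="'b mod_ring"] by (simp add: p_def)
    then have "2 ^ n * \<bar>?t - 1 / (1 + 1 / real p)\<bar> \<le> 2 ^ n * (1 / fact r + 1 / real p ^ D + 1 / real p ^ n)"
      by (intro mult_left_mono) auto
    moreover have "\<bar>2 ^ n * ?t - 2 ^ n * (1 / (1 + 1 / real p))\<bar> = \<bar>2 ^ n * (?t - 1 / (1 + 1 / real p))\<bar>"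
      by (simp only: right_diff_distrib)
    ultimately show ?thesis by (simp add: abs_mult)
  qed
  ultimately have "\<bar>real (card ?G) - 2 ^ n * (1 / (1 + 1 / real p))\<bar>
      \<le> 2 ^ n * (real (n + 1) / 2 ^ D)
        + 2 ^ n * (1 / fact r + real p ^ (Suc D * r) * \<rho> ^ (n div (2 * r * D)))
        + 2 ^ n * (1 / fact r + 1 / real p ^ D + 1 / real p ^ n)"
    by linarith
  then show ?thesis by (simp add: algebra_simps)
qed

text \<open>Used with \<open>m = n - 2\<close>: the error bound for degree \<open>n - 2\<close> exceeds that for degree \<open>n\<close> at most by
the factor \<open>p\<close>.\<close>

lemma fourth_root_shift:
  assumes "m \<ge> 1"
  shows "real (m + 2) powr (1/4) \<le> real m powr (1/4) + 1"
proof -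
  define y where "y = real m powr (1/4)"
  have y: "y \<ge> 1" using assms by (simp add: y_def ge_one_powr_ge_zero)
  have y4: "y ^ 4 = real m" using assms by (simp add: y_def powr_powr flip: powr_numeral)
  have "y ^ 4 + 2 \<le> (y + 1) ^ 4"
  proof -
    have "(y + 1) ^ 4 = y ^ 4 + 4 * y ^ 3 + 6 * y ^ 2 + 4 * y + 1"
      by (simp add: power4_eq_xxxx power3_eq_cube power2_eq_square algebra_simps)
    moreover have "0 \<le> y ^ 3" "0 \<le> y ^ 2" using y by auto
    ultimately show ?thesis using y by linarith
  qed
  then have "real (m + 2) powr (1/4) \<le> ((y + 1) ^ 4) powr (1/4)"
    using y4 by (intro powr_mono2) auto
  also have "\<dots> = y + 1" using y by (simp add: powr_powr flip: powr_numeral)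
  finally show ?thesis by (simp add: y_def)
qed

lemma squarefree_01_approx:
  fixes p :: nat
  defines "p \<equiv> CARD('b :: prime_card)"
  obtains K N where "\<And>n. n \<ge> N \<Longrightarrow>
    \<bar>real (card {f\<in>monics {0, 1} n. squarefree (f :: 'b mod_ring poly)}) - 2 ^ n * (3/4 * (1 / (1 + 1 / real p)))\<bar>
      \<le> 2 ^ n * (K * real p powr (- (real n powr (1/4))))"
proof -
  let ?e = "\<lambda>n. real p powr (- (real n powr (1/4)))"
  let ?k = "1 / (1 + 1 / real p)"
  let ?T = "\<lambda>n. real (card {f\<in>monics {0, 1} n. squarefree_away (f :: 'b mod_ring poly)})"
  have p: "p \<ge> 2" unfolding p_def by (rule prime_ge_2_nat[OF prime_card])
  obtain \<rho> :: real where rho: "0 < \<rho>" "\<rho> < 1"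
      "\<And>x :: 'b mod_ring. x \<noteq> 0 \<Longrightarrow> norm (1 + additive_character x) \<le> 2 * \<rho>"
    using additive_character_contraction[where 'b='b] by blast
  obtain K N where K: "K \<ge> 0" and KN: "\<And>n. n \<ge> N \<Longrightarrow> \<exists>r D. 2 * r * D \<le> n \<and> p * D \<le> n \<and>
       2 / fact r + real p ^ (Suc D * r) * \<rho> ^ (n div (2 * r * D)) + 1 / real p ^ D + 1 / real p ^ n
         + real (n + 1) / 2 ^ D \<le> K * ?e n"
    using sieve_parameters[OF p rho(1,2)] by blast
  have T: "\<bar>?T n - 2 ^ n * ?k\<bar> \<le> 2 ^ n * (K * ?e n)" if n: "n \<ge> N" for n
  proof -
    obtain r D where rD: "2 * r * D \<le> n" "p * D \<le> n" and
      le: "2 / fact r + real p ^ (Suc D * r) * \<rho> ^ (n div (2 * r * D)) + 1 / real p ^ D + 1 / real p ^ n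
         + real (n + 1) / 2 ^ D \<le> K * ?e n"
      using KN[OF n] by blast
    show ?thesis
      using squarefree_away_01_approx[OF rho rD(1) rD(2)[unfolded p_def]] mult_left_mono[OF le, of "2 ^ n"]
      unfolding p_def by (rule order.trans) auto
  qed
  show ?thesis
  proof (rule that[of "N + 3" "K * (1 + real p)"])
    fix n assume n: "n \<ge> N + 3"
    define m where "m = n - 2"
    have nm: "n = m + 2" "m \<ge> N" "m \<ge> 1" using n by (auto simp: m_def)
    have combine: "\<bar>s - b * (3/4 * x)\<bar> \<le> u + v"
      if "s + t' = t" "\<bar>t - b * x\<bar> \<le> u" "\<bar>t' - b' * x\<bar> \<le> v" "b = 4 * b'" for s t t' b b' x u v :: real
    proof -
      have "b * x = 4 * (b' * x)" "b * (3/4 * x) = 3 * (b' * x)" using that(4) by simp_all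
      then show ?thesis using that(1-3) by linarith
    qed
    have "real (card {f\<in>monics {0, 1} n. squarefree (f :: 'b mod_ring poly)}) + ?T m = ?T n"
      unfolding nm(1) by (subst card_squarefree_recursion[symmetric]) auto
    moreover have "\<bar>?T n - 2 ^ n * ?k\<bar> \<le> 2 ^ n * (K * ?e n)" "\<bar>?T m - 2 ^ m * ?k\<bar> \<le> 2 ^ m * (K * ?e m)"
      by (rule T, use nm in linarith, rule T, use nm in linarith)
    moreover have "(2 :: real) ^ n = 4 * 2 ^ m" by (simp add: nm(1))
    ultimately have "\<bar>real (card {f\<in>monics {0, 1} n. squarefree (f :: 'b mod_ring poly)}) - 2 ^ n * (3/4 * ?k)\<bar>
        \<le> 2 ^ n * (K * ?e n) + 2 ^ m * (K * ?e m)"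
      by (rule combine)
    also have "?e m \<le> real p * ?e n"
    proof -
      have "- (real m powr (1/4)) \<le> 1 + - (real n powr (1/4))"
        using fourth_root_shift[OF nm(3)] unfolding nm(1) by linarith
      then have "?e m \<le> real p powr (1 + - (real n powr (1/4)))"
        using p by (intro powr_mono) auto
      also have "\<dots> = real p * ?e n" using p by (simp only: powr_add powr_one)
      finally show ?thesis .
    qed
    then have "2 ^ m * (K * ?e m) \<le> 2 ^ n * (K * (real p * ?e n))"
      using K nm by (intro mult_mono power_increasing) auto
    finally show "\<bar>real (card {f\<in>monics {0, 1} n. squarefree (f :: 'b mod_ring poly)}) - 2 ^ n * (3/4 * ?k)\<bar>
        \<le> 2 ^ n * (K * (1 + real p) * ?e n)"
      by (simp add: algebra_simps)
  qed
qed

theorem theorem1p1: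
  fixes p k :: nat
  assumes "prime p" and "k \<ge> 1" and "CARD('a :: finite_field) = p ^ k"
  shows "\<exists>E :: nat \<Rightarrow> real.
           E \<in> O[at_top](\<lambda>n. real p powr (- (real n powr (1/4)))) \<and>
           (\<forall>n. real (card {f :: 'a poly. degree f = n \<and> lead_coeff f = 1 \<and> squarefree f \<and>
                                         (\<forall>i. poly.coeff f i \<in> {0, 1})})
                = 3/4 * (1 / (1 + 1 / real p)) * 2 ^ n * (1 + E n))"
proof -
  let ?e = "\<lambda>n. real p powr (- (real n powr (1/4)))"
  define c where "c = 3/4 * (1 / (1 + 1 / real p))"
  define s where "s n = real (card {f :: 'a poly. degree f = n \<and> lead_coeff f = 1 \<and> squarefree f \<and>
                                         (\<forall>i. poly.coeff f i \<in> {0, 1})})" for n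
  define E where "E n = s n / (c * 2 ^ n) - 1" for n
  have c: "c > 0" unfolding c_def by (intro mult_pos_pos divide_pos_pos add_pos_nonneg) auto
  have p: "CARD('a ring_char) = p"
    using CHAR_eq_if_card_prime_power[OF assms(1,3)] by simp
  have s: "s n = real (card {f\<in>monics {0, 1 :: 'a ring_char mod_ring} n. squarefree f})" for n
  proof -
    have "{f :: 'a poly. degree f = n \<and> lead_coeff f = 1 \<and> squarefree f \<and> (\<forall>i. poly.coeff f i \<in> {0, 1})}
        = {f\<in>monics {0, 1} n. squarefree f}"
      by (auto simp: monics_def)
    then show ?thesis unfolding s_def by (simp only: card_squarefree_01_prime_field[where 'a='a])
  qed
  obtain K N where approx: "\<And>n. n \<ge> N \<Longrightarrow> \<bar>s n - 2 ^ n * c\<bar> \<le> 2 ^ n * (K * ?e n)"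
    using squarefree_01_approx[where 'b="'a ring_char"] unfolding p s c_def by blast
  have "norm (E n) \<le> (K / c) * norm (?e n)" if "n \<ge> N" for n
  proof -
    have "E n = (s n - 2 ^ n * c) / (c * 2 ^ n)" using c by (simp add: E_def field_simps)
    then have "\<bar>E n\<bar> = \<bar>s n - 2 ^ n * c\<bar> / (c * 2 ^ n)" using c by (simp add: abs_mult)
    also have "\<dots> \<le> 2 ^ n * (K * ?e n) / (c * 2 ^ n)" using approx[OF that] c by (intro divide_right_mono) auto
    finally show ?thesis using c by (simp add: field_simps)
  qed
  then have "E \<in> O[at_top](?e)"
    by (intro bigoI[of _ "K / c"]) (auto simp: eventually_at_top_linorder)
  moreover have "s n = c * 2 ^ n * (1 + E n)" for n
    using c by (simp add: E_def)
  ultimately show ?thesis unfolding s_def c_def by blast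
qed

end
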